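(* Let $R$ be a ring, $\mathfrak{F}_l$ a Gabriel filter of left ideals of $R$, $\mathfrak{F}_r$ a Gabriel filter of right ideals of $R$, and let ${}_l\mathfrak{F}_r$ be the symmetric Gabriel filter induced by $\mathfrak{F}_l$ and $\mathfrak{F}_r$, corresponding to the torsion theory ${}_l\tau_r$, with torsion submodule ${}_l\mathcal{T}_r(M)$ for each $R$-bimodule $M$. The following conditions are equivalent. (1) ${}_l\mathfrak{F}_r$ is a differential filter. (2) For every $R$-bimodule $M$, every derivation $\delta$ on $R$ and every $\delta$-derivation $d$ on $M$, $d({}_l\mathcal{T}_r(M))\subseteq {}_l\mathcal{T}_r(M)$. (3) For every $R$-bimodule $M$, every derivation $\delta$ on $R$ and every $x\in {}_l\mathcal{T}_r(M)$, there is $K\in {}_l\mathfrak{F}_r$ such that $\overline{\delta}(K)\subseteq {}_l\mathrm{ann}_r(x)$. Moreover, if $\mathfrak{F}_l$ and $\mathfrak{F}_r$ are differential, then ${}_l\mathfrak{F}_r$ is also differential.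
   Context: Rings are associative with identity and modules are unital. Derivations. A derivation on a ring $R$ is an additive map $\delta:R\to R$ with $\delta(rs)=\delta(r)s+r\delta(s)$. Every derivation $\delta$ on $R$ determines a derivation $\overline{\delta}$ on $R\otimes_{\mathbb{Z}}R^{op}$ by $\overline{\delta}(r\otimes s)=\delta(r)\otimes s+r\otimes\delta(s)$; this is the meaning of $\overline{\delta}$ in (3). For an $R$-bimodule $M$, a $\delta$-derivation on $M$ is an additive map $d:M\to M$ with $d(xr)=d(x)r+x\delta(r)$ and $d(rx)=\delta(r)x+rd(x)$ for all $x\in M$, $r\in R$. Bimodules as right modules. An $R$-bimodule $M$ is a right $R\otimes_{\mathbb{Z}}R^{op}$-module via $x(r\otimes s)=sxr$. For $x\in M$, ${}_l\mathrm{ann}_r(x)=\{t\in R\otimes_{\mathbb{Z}} R^{op} : xt=0\}$. Symmetric filter. ${}_l\mathfrak{F}_r$ is the set of right ideals of $R\otimes_{\mathbb{Z}}R^{op}$ containing one of the form $J\otimes R^{op}+R\otimes I$ (meaning the sum of the images in $R\otimes_{\mathbb{Z}}R^{op}$) with $I\in\mathfrak{F}_l$, $J\in\mathfrak{F}_r$. It is a Gabriel filter, and its torsion submodule is ${}_l\mathcal{T}_r(M)=\{x\in M:{}_l\mathrm{ann}_r(x)\in{}_l\mathfrak{F}_r\}=\mathcal{T}_l(M)\cap\mathcal{T}_r(M)$, where $\mathcal{T}_l,\mathcal{T}_r$ are the torsion submodules for $\mathfrak{F}_l,\mathfrak{F}_r$. Differential filters. A Gabriel filter $\mathfrak{F}$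 of one-sided (left or right) ideals of $R$ is differential if for every $I\in\mathfrak{F}$ there is $J\in\mathfrak{F}$ such that $\delta(J)\subseteq I$ for all derivations $\delta$ on $R$. The symmetric filter ${}_l\mathfrak{F}_r$ is differential if for every $I\in{}_l\mathfrak{F}_r$ there is $J\in{}_l\mathfrak{F}_r$ such that $\overline{\delta}(J)\subseteq I$ for all derivations $\overline{\delta}$ of the ring $R\otimes_{\mathbb{Z}}R^{op}$.
   Formalization: "Differential" is taken with J allowed to depend on the derivation: for every derivation δ and every I in the filter there is J with δ(J) ⊆ I; with one J for all δ, (2) does not imply (1) (first Weyl algebra, all nonzero one-sided ideals). *)

theory Defs
  imports "HOL-Algebra.QuotRing" "HOL-Algebra.Generated_Groups" "HOL-Algebra.Free_Abelian_Groups"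
begin

section \<open>Opposite rings, one-sided ideals, Gabriel filters\<close>

definition op_ring :: "('a, 'k) ring_scheme \<Rightarrow> ('a, 'k) ring_scheme"
  where "op_ring R = R\<lparr>mult := (\<lambda>x y. y \<otimes>\<^bsub>R\<^esub> x)\<rparr>"

definition right_ideal :: "('a, 'k) ring_scheme \<Rightarrow> 'a set \<Rightarrow> bool"
  where "right_ideal R I \<longleftrightarrow>
    additive_subgroup I R \<and> (\<forall>x\<in>I. \<forall>r\<in>carrier R. x \<otimes>\<^bsub>R\<^esub> r \<in> I)"

definition right_residual :: "('a, 'k) ring_scheme \<Rightarrow> 'a set \<Rightarrow> 'a \<Rightarrow> 'a set"
  where "right_residual R I a = {r \<in> carrier R. a \<otimes>\<^bsub>R\<^esub> r \<in> I}"

definition right_gabriel_filter :: "('a, 'k) ring_scheme \<Rightarrow> 'a set set \<Rightarrow> bool"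
  where "right_gabriel_filter R F \<longleftrightarrow>
    F \<noteq> {} \<and>
    (\<forall>I\<in>F. right_ideal R I) \<and>
    (\<forall>I\<in>F. \<forall>J. right_ideal R J \<and> I \<subseteq> J \<longrightarrow> J \<in> F) \<and>
    (\<forall>I\<in>F. \<forall>J\<in>F. I \<inter> J \<in> F) \<and>
    (\<forall>I\<in>F. \<forall>a\<in>carrier R. right_residual R I a \<in> F) \<and>
    (\<forall>I. \<forall>J\<in>F. right_ideal R I \<and> (\<forall>a\<in>J. right_residual R I a \<in> F) \<longrightarrow> I \<in> F)"

definition left_gabriel_filter :: "('a, 'k) ring_scheme \<Rightarrow> 'a set set \<Rightarrow> bool"
  where "left_gabriel_filter R F \<longleftrightarrow> right_gabriel_filter (op_ring R) F"


section \<open>Derivations and differential filters\<close>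

definition derivation :: "('a, 'k) ring_scheme \<Rightarrow> ('a \<Rightarrow> 'a) \<Rightarrow> bool"
  where "derivation R \<delta> \<longleftrightarrow>
    \<delta> \<in> carrier R \<rightarrow> carrier R \<and>
    (\<forall>r\<in>carrier R. \<forall>s\<in>carrier R. \<delta> (r \<oplus>\<^bsub>R\<^esub> s) = \<delta> r \<oplus>\<^bsub>R\<^esub> \<delta> s) \<and>
    (\<forall>r\<in>carrier R. \<forall>s\<in>carrier R.
      \<delta> (r \<otimes>\<^bsub>R\<^esub> s) = (\<delta> r \<otimes>\<^bsub>R\<^esub> s) \<oplus>\<^bsub>R\<^esub> (r \<otimes>\<^bsub>R\<^esub> \<delta> s))"

text \<open>
  The derivation is quantified first, so \<open>J\<close> may depend on it. A \<open>J\<close> uniform in the derivation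
  is a different notion: already for inner derivations it fails for the filter of all nonzero right
  ideals of the first Weyl algebra over the rationals, where every \<open>\<delta>\<close>-derivation of a module
  preserves torsion.
  The same definition serves for filters of left ideals: \<open>R\<close> and its opposite ring have the same
  derivations.
\<close>

definition differential_filter :: "('a, 'k) ring_scheme \<Rightarrow> 'a set set \<Rightarrow> bool"
  where "differential_filter R F \<longleftrightarrow>
    (\<forall>\<delta>. derivation R \<delta> \<longrightarrow> (\<forall>I\<in>F. \<exists>J\<in>F. \<delta> ` J \<subseteq> I))"


section \<open>Tensor products of rings over the integers\<close>

text \<open>
  The free abelian group on \<open>carrier A \<times> carrier B\<close>, with componentwise multiplication of
  generators extended biadditively.
\<close>

definition free_tensor_ring ::
    "('a, 'k) ring_scheme \<Rightarrow> ('b, 'l) ring_scheme \<Rightarrow> ('a \<times> 'b \<Rightarrow>\<^sub>0 int) ring"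
  where "free_tensor_ring A B =
    \<lparr>carrier = {p. Poly_Mapping.keys p \<subseteq> carrier A \<times> carrier B},
     monoid.mult = (\<lambda>p q. frag_extend (\<lambda>(a, b). frag_extend (\<lambda>(c, d).
       frag_of (a \<otimes>\<^bsub>A\<^esub> c, b \<otimes>\<^bsub>B\<^esub> d)) q) p),
     one = frag_of (\<one>\<^bsub>A\<^esub>, \<one>\<^bsub>B\<^esub>),
     ring.zero = 0,
     add = (+)\<rparr>"

definition tensor_relations ::
    "('a, 'k) ring_scheme \<Rightarrow> ('b, 'l) ring_scheme \<Rightarrow> ('a \<times> 'b \<Rightarrow>\<^sub>0 int) set"
  where "tensor_relations A B =
    {frag_of (a \<oplus>\<^bsub>A\<^esub> a', b) - frag_of (a, b) - frag_of (a', b) |a a' b.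
       a \<in> carrier A \<and> a' \<in> carrier A \<and> b \<in> carrier B} \<union>
    {frag_of (a, b \<oplus>\<^bsub>B\<^esub> b') - frag_of (a, b) - frag_of (a, b') |a b b'.
       a \<in> carrier A \<and> b \<in> carrier B \<and> b' \<in> carrier B}"

definition tensor_kernel ::
    "('a, 'k) ring_scheme \<Rightarrow> ('b, 'l) ring_scheme \<Rightarrow> ('a \<times> 'b \<Rightarrow>\<^sub>0 int) set"
  where "tensor_kernel A B =
    generate (add_monoid (free_tensor_ring A B)) (tensor_relations A B)"

text \<open>
  The subgroup \<open>tensor_kernel A B\<close> is a two-sided ideal of \<open>free_tensor_ring A B\<close>, because a
  relation times a generator is again a relation, so the quotient by it is a ring.
\<close>

definition tensor_ring ::
    "('a, 'k) ring_scheme \<Rightarrow> ('b, 'l) ring_scheme \<Rightarrow> ('a \<times> 'b \<Rightarrow>\<^sub>0 int) set ring"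
  where "tensor_ring A B = free_tensor_ring A B Quot tensor_kernel A B"

definition tens ::
    "('a, 'k) ring_scheme \<Rightarrow> ('b, 'l) ring_scheme \<Rightarrow> 'a \<Rightarrow> 'b \<Rightarrow> ('a \<times> 'b \<Rightarrow>\<^sub>0 int) set"
  where "tens A B a b = tensor_kernel A B +>\<^bsub>free_tensor_ring A B\<^esub> frag_of (a, b)"

text \<open>The image of \<open>U \<otimes> V\<close> in \<open>A \<otimes> B\<close>, for additive subgroups \<open>U\<close> of \<open>A\<close> and \<open>V\<close> of \<open>B\<close>.\<close>

definition tensor_image ::
    "('a, 'k) ring_scheme \<Rightarrow> ('b, 'l) ring_scheme \<Rightarrow> 'a set \<Rightarrow> 'b set \<Rightarrow> ('a \<times> 'b \<Rightarrow>\<^sub>0 int) set set"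
  where "tensor_image A B U V =
    generate (add_monoid (tensor_ring A B)) {tens A B u v |u v. u \<in> U \<and> v \<in> V}"

definition env_ring :: "('a, 'k) ring_scheme \<Rightarrow> ('a \<times> 'a \<Rightarrow>\<^sub>0 int) set ring"
  where "env_ring R = tensor_ring R (op_ring R)"

text \<open>
  The additive map with \<open>r \<otimes> s \<mapsto> \<delta> r \<otimes> s + r \<otimes> \<delta> s\<close>. It is defined on representatives; for a
  derivation \<open>\<delta>\<close> all representatives of \<open>t\<close> give the same coset, so the union is that coset.
\<close>

definition env_derivation ::
    "('a, 'k) ring_scheme \<Rightarrow> ('a \<Rightarrow> 'a) \<Rightarrow> ('a \<times> 'a \<Rightarrow>\<^sub>0 int) set \<Rightarrow> ('a \<times> 'a \<Rightarrow>\<^sub>0 int) set"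
  where "env_derivation R \<delta> t =
    (\<Union>p\<in>t. tensor_kernel R (op_ring R) +>\<^bsub>free_tensor_ring R (op_ring R)\<^esub>
      frag_extend (\<lambda>(r, s). frag_of (\<delta> r, s) + frag_of (r, \<delta> s)) p)"


section \<open>Bimodules\<close>

text \<open>As for the library's modules, the multiplicative ring fields of the record are unused.\<close>

record ('a, 'm) bimodule = "'m ring" +
  lact :: "'a \<Rightarrow> 'm \<Rightarrow> 'm"
  ract :: "'m \<Rightarrow> 'a \<Rightarrow> 'm"

locale bimodule = R: ring R + M: abelian_group M
  for R :: "('a, 'k) ring_scheme" and M :: "('a, 'm, 'l) bimodule_scheme" +
  assumes lact_closed: "\<lbrakk>r \<in> carrier R; x \<in> carrier M\<rbrakk> \<Longrightarrow> lact M r x \<in> carrier M"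
    and ract_closed: "\<lbrakk>r \<in> carrier R; x \<in> carrier M\<rbrakk> \<Longrightarrow> ract M x r \<in> carrier M"
    and lact_add_scalar: "\<lbrakk>r \<in> carrier R; s \<in> carrier R; x \<in> carrier M\<rbrakk>
      \<Longrightarrow> lact M (r \<oplus>\<^bsub>R\<^esub> s) x = lact M r x \<oplus>\<^bsub>M\<^esub> lact M s x"
    and ract_add_scalar: "\<lbrakk>r \<in> carrier R; s \<in> carrier R; x \<in> carrier M\<rbrakk>
      \<Longrightarrow> ract M x (r \<oplus>\<^bsub>R\<^esub> s) = ract M x r \<oplus>\<^bsub>M\<^esub> ract M x s"
    and lact_add: "\<lbrakk>r \<in> carrier R; x \<in> carrier M; y \<in> carrier M\<rbrakk>
      \<Longrightarrow> lact M r (x \<oplus>\<^bsub>M\<^esub> y) = lact M r x \<oplus>\<^bsub>M\<^esub> lact M r y"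
    and ract_add: "\<lbrakk>r \<in> carrier R; x \<in> carrier M; y \<in> carrier M\<rbrakk>
      \<Longrightarrow> ract M (x \<oplus>\<^bsub>M\<^esub> y) r = ract M x r \<oplus>\<^bsub>M\<^esub> ract M y r"
    and lact_mult: "\<lbrakk>r \<in> carrier R; s \<in> carrier R; x \<in> carrier M\<rbrakk>
      \<Longrightarrow> lact M (r \<otimes>\<^bsub>R\<^esub> s) x = lact M r (lact M s x)"
    and ract_mult: "\<lbrakk>r \<in> carrier R; s \<in> carrier R; x \<in> carrier M\<rbrakk>
      \<Longrightarrow> ract M x (r \<otimes>\<^bsub>R\<^esub> s) = ract M (ract M x r) s"
    and lact_one: "x \<in> carrier M \<Longrightarrow> lact M \<one>\<^bsub>R\<^esub> x = x"
    and ract_one: "x \<in> carrier M \<Longrightarrow> ract M x \<one>\<^bsub>R\<^esub> = x"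
    and lact_ract: "\<lbrakk>r \<in> carrier R; s \<in> carrier R; x \<in> carrier M\<rbrakk>
      \<Longrightarrow> lact M r (ract M x s) = ract M (lact M r x) s"

definition bimodule_derivation ::
    "('a, 'k) ring_scheme \<Rightarrow> ('a, 'm, 'l) bimodule_scheme \<Rightarrow> ('a \<Rightarrow> 'a) \<Rightarrow> ('m \<Rightarrow> 'm) \<Rightarrow> bool"
  where "bimodule_derivation R M \<delta> d \<longleftrightarrow>
    d \<in> carrier M \<rightarrow> carrier M \<and>
    (\<forall>x\<in>carrier M. \<forall>y\<in>carrier M. d (x \<oplus>\<^bsub>M\<^esub> y) = d x \<oplus>\<^bsub>M\<^esub> d y) \<and>
    (\<forall>x\<in>carrier M. \<forall>r\<in>carrier R. d (ract M x r) = ract M (d x) r \<oplus>\<^bsub>M\<^esub> ract M x (\<delta> r)) \<and>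
    (\<forall>x\<in>carrier M. \<forall>r\<in>carrier R. d (lact M r x) = lact M (\<delta> r) x \<oplus>\<^bsub>M\<^esub> lact M r (d x))"

text \<open>
  The right action \<open>x (r \<otimes> s) = s x r\<close>, first on formal sums. On a bimodule all representatives
  of an element \<open>t\<close> of the enveloping ring act in the same way, so the image below is a singleton.
\<close>

definition formal_act :: "('a, 'm, 'l) bimodule_scheme \<Rightarrow> 'm \<Rightarrow> ('a \<times> 'a \<Rightarrow>\<^sub>0 int) \<Rightarrow> 'm"
  where "formal_act M x p =
    finsum M (\<lambda>(r, s). [Poly_Mapping.lookup p (r, s)] \<cdot>\<^bsub>M\<^esub> lact M s (ract M x r))
      (Poly_Mapping.keys p)"

definition env_act :: "('a, 'm, 'l) bimodule_scheme \<Rightarrow> 'm \<Rightarrow> ('a \<times> 'a \<Rightarrow>\<^sub>0 int) set \<Rightarrow> 'm"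
  where "env_act M x t = the_elem (formal_act M x ` t)"

definition env_ann ::
    "('a, 'k) ring_scheme \<Rightarrow> ('a, 'm, 'l) bimodule_scheme \<Rightarrow> 'm \<Rightarrow> ('a \<times> 'a \<Rightarrow>\<^sub>0 int) set set"
  where "env_ann R M x = {t \<in> carrier (env_ring R). env_act M x t = \<zero>\<^bsub>M\<^esub>}"


section \<open>The symmetric filter and its torsion submodules\<close>

definition symmetric_filter ::
    "('a, 'k) ring_scheme \<Rightarrow> 'a set set \<Rightarrow> 'a set set \<Rightarrow> ('a \<times> 'a \<Rightarrow>\<^sub>0 int) set set set"
  where "symmetric_filter R Fl Fr =
    {K. right_ideal (env_ring R) K \<and>
      (\<exists>I\<in>Fl. \<exists>J\<in>Fr.
        tensor_image R (op_ring R) J (carrier R) <+>\<^bsub>env_ring R\<^esub>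
        tensor_image R (op_ring R) (carrier R) I \<subseteq> K)}"

definition symmetric_torsion ::
    "('a, 'k) ring_scheme \<Rightarrow> 'a set set \<Rightarrow> 'a set set \<Rightarrow> ('a, 'm, 'l) bimodule_scheme \<Rightarrow> 'm set"
  where "symmetric_torsion R Fl Fr M =
    {x \<in> carrier M. env_ann R M x \<in> symmetric_filter R Fl Fr}"

end

theory Submission
  imports Defs
begin

text \<open>
  Every Gabriel filter is differential: for a derivation \<open>D\<close> and \<open>I\<close> in the filter, the right ideal
  \<open>J = {x \<in> I. D x \<in> I}\<close> has at each \<open>a \<in> I\<close> the residual of \<open>I\<close> at \<open>D a\<close>, so \<open>J\<close> is in the filter.
  The symmetric filter is a Gabriel filter, because membership of \<open>K\<close> is tested on the contractions
  of \<open>K\<close> along \<open>r \<mapsto> r \<otimes> 1\<close> and \<open>s \<mapsto> 1 \<otimes> s\<close>, and residuals and the locality axiom are compatible with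
  both contractions. Hence (1) always holds, and (3) is the instance \<open>D = \<delta>\<close> extended to the
  enveloping ring, \<open>I\<close> the annihilator of \<open>x\<close>. For (2), the identity \<open>d (x t) = d x t + x D t\<close> shows
  that \<open>J\<close> annihilates \<open>d x\<close>.
\<close>

section \<open>One-sided ideals and Gabriel filters\<close>

text \<open>The step from \<open>I\<close> to \<open>J\<close> works because
  \<open>D (a \<otimes> r)\<close> is \<open>D a \<otimes> r\<close> plus
  \<open>a \<otimes> D r\<close>, and the second term lies in the right ideal \<open>I\<close> for
  every \<open>r\<close> once \<open>a\<close> does. The residual of \<open>J\<close> at
  \<open>a\<close> therefore contains that of \<open>I\<close> at \<open>D a\<close>, and locality
  can be tested along \<open>I\<close> itself. For the symmetric filter the obstacle is the residual
  at a general tensor \<open>t\<close>: since \<open>t\<close> comes from neither factor,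
  contracting its residual does not give a residual of the contraction. Up to differences
  \<open>t\<close> is a pure tensor, a product of one element from each factor, and these two
  commute. The foreign one can be moved to the far right, where a right ideal absorbs it. Two
  contractions suffice because a right ideal containing \<open>a \<otimes> 1\<close> contains every
  \<open>a \<otimes> b\<close>, and likewise on the other side. Tensors are cosets of formal sums,
  so the extended derivation and the action on a bimodule both come from additive maps on formal
  sums that vanish on the tensor relations; identities about them then need checking on pure tensors
  only.\<close>

context ring
begin

text \<open>Negatives arise as \<open>0 - x\<close> and sums as \<open>x - (- y)\<close>, so the
  right ideals constructed below need a single additive check.\<close>

lemma right_idealI:
  assumes "I \<subseteq> carrier R" and "\<zero> \<in> I"
    and "\<And>x y. x \<in> I \<Longrightarrow> y \<in> I \<Longrightarrow> x \<ominus> y \<in> I"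
    and "\<And>x r. x \<in> I \<Longrightarrow> r \<in> carrier R \<Longrightarrow> x \<otimes> r \<in> I"
  shows "right_ideal R I"
proof -
  have neg: "\<ominus> x \<in> I" if "x \<in> I" for x
    using assms(3)[OF assms(2) that] assms(1) that by (auto simp: minus_eq)
  have "x \<oplus> y \<in> I" if "x \<in> I" "y \<in> I" for x y
    using assms(3)[OF that(1) neg[OF that(2)]] assms(1) that by (auto simp: minus_eq)
  then have "subgroup I (add_monoid R)"
    using assms(1,2) neg by unfold_locales (auto simp: a_inv_def)
  then show ?thesis
    using assms(4) by (auto simp: right_ideal_def additive_subgroup_def)
qed

lemma right_idealD:
  assumes "right_ideal R I"
  shows right_ideal_subset: "I \<subseteq> carrier R"
    and right_ideal_zero: "\<zero> \<in> I"
    and right_ideal_add: "\<And>x y. x \<in> I \<Longrightarrow> y \<in> I \<Longrightarrow> x \<oplus> y \<in> I"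
    and right_ideal_minus: "\<And>x y. x \<in> I \<Longrightarrow> y \<in> I \<Longrightarrow> x \<ominus> y \<in> I"
    and right_ideal_mult: "\<And>x r. x \<in> I \<Longrightarrow> r \<in> carrier R \<Longrightarrow> x \<otimes> r \<in> I"
proof -
  interpret additive_subgroup I R using assms by (simp add: right_ideal_def)
  show "I \<subseteq> carrier R" by (rule a_subset)
  show "\<zero> \<in> I" by simp
  show "x \<oplus> y \<in> I" if "x \<in> I" "y \<in> I" for x y using that by simp
  show "x \<ominus> y \<in> I" if "x \<in> I" "y \<in> I" for x y using that by (simp add: minus_eq)
  show "x \<otimes> r \<in> I" if "x \<in> I" "r \<in> carrier R" for x r
    using assms that by (simp add: right_ideal_def)
qed

lemma right_ideal_inter:
  assumes "right_ideal R I" and "right_ideal R J"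
  shows "right_ideal R (I \<inter> J)"
  using right_idealD[OF assms(1)] right_idealD[OF assms(2)] by (intro right_idealI) auto

lemma right_ideal_residual:
  assumes I: "right_ideal R I" and a: "a \<in> carrier R"
  shows "right_ideal R (right_residual R I a)"
proof (rule right_idealI)
  show "x \<ominus> y \<in> right_residual R I a"
    if "x \<in> right_residual R I a" "y \<in> right_residual R I a" for x y
    using that a right_ideal_minus[OF I, of "a \<otimes> x" "a \<otimes> y"]
    by (simp add: right_residual_def minus_eq r_distr r_minus)
  show "x \<otimes> r \<in> right_residual R I a"
    if "x \<in> right_residual R I a" "r \<in> carrier R" for x r
    using that a right_ideal_mult[OF I, of "a \<otimes> x" r] by (simp add: right_residual_def m_assoc)
qed (use a right_ideal_zero[OF I] in \<open>auto simp: right_residual_def\<close>)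

lemma derivation_hom:
  assumes "derivation R D"
  shows "abelian_group_hom R R D"
  using assms
  by (intro abelian_group_homI group_hom.intro group_hom_axioms.intro
      abelian_group_axioms add.is_group homI)
    (auto simp: derivation_def)

text \<open>In \<open>D (x \<otimes> r)\<close> the term \<open>x \<otimes> D r\<close> is
  controlled only when \<open>x\<close> itself lies in \<open>I\<close>. Hence the intersection with
  \<open>I\<close> instead of the plain preimage of \<open>I\<close> under \<open>D\<close>.\<close>

lemma right_ideal_derivation_vimage:
  assumes D: "derivation R D" and I: "right_ideal R I"
  shows "right_ideal R {x \<in> I. D x \<in> I}"
proof -
  interpret D: abelian_group_hom R R D by (rule derivation_hom[OF D])
  note Id = right_idealD[OF I]
  have mult: "D (x \<otimes> y) = (D x \<otimes> y) \<oplus> (x \<otimes> D y)" if "x \<in> carrier R" "y \<in> carrier R" for x y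
    using D that by (simp add: derivation_def)
  show ?thesis
  proof (rule right_idealI)
    show "x \<ominus> y \<in> {x \<in> I. D x \<in> I}" if "x \<in> {x \<in> I. D x \<in> I}" "y \<in> {x \<in> I. D x \<in> I}" for x y
    proof -
      have "x \<in> carrier R" "y \<in> carrier R" using that Id(1) by auto
      then have "D (x \<ominus> y) = D x \<ominus> D y"
        using D.hom_add[of x "\<ominus> y"] D.hom_a_inv[of y] by (simp add: minus_eq)
      then show ?thesis using that Id(4) by auto
    qed
    show "x \<otimes> r \<in> {x \<in> I. D x \<in> I}" if "x \<in> {x \<in> I. D x \<in> I}" "r \<in> carrier R" for x r
    proof -
      have "D (x \<otimes> r) = (D x \<otimes> r) \<oplus> (x \<otimes> D r)" using that Id(1) by (auto intro: mult)
      then show ?thesis using that Id(3,5) by auto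
    qed
  qed (use Id in auto)
qed

end

lemma right_gabriel_filterD:
  assumes "right_gabriel_filter A F"
  shows gabriel_right_ideal: "\<And>I. I \<in> F \<Longrightarrow> right_ideal A I"
    and gabriel_upward: "\<And>I J. I \<in> F \<Longrightarrow> right_ideal A J \<Longrightarrow> I \<subseteq> J \<Longrightarrow> J \<in> F"
    and gabriel_inter: "\<And>I J. I \<in> F \<Longrightarrow> J \<in> F \<Longrightarrow> I \<inter> J \<in> F"
    and gabriel_residual: "\<And>I a. I \<in> F \<Longrightarrow> a \<in> carrier A \<Longrightarrow> right_residual A I a \<in> F"
    and gabriel_local: "\<And>I J. J \<in> F \<Longrightarrow> right_ideal A I \<Longrightarrow>
      (\<And>a. a \<in> J \<Longrightarrow> right_residual A I a \<in> F) \<Longrightarrow> I \<in> F"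
proof -
  note conds = assms[unfolded right_gabriel_filter_def]
  show "right_ideal A I" if "I \<in> F" for I
    using conds[THEN conjunct2, THEN conjunct1] that by (rule bspec)
  show "J \<in> F" if "I \<in> F" "right_ideal A J" "I \<subseteq> J" for I J
    using conds[THEN conjunct2, THEN conjunct2, THEN conjunct1, rule_format, OF that(1) conjI]
      that(2,3) .
  show "I \<inter> J \<in> F" if "I \<in> F" "J \<in> F" for I J
    using conds[THEN conjunct2, THEN conjunct2, THEN conjunct2, THEN conjunct1, rule_format, OF that] .
  show "right_residual A I a \<in> F" if "I \<in> F" "a \<in> carrier A" for I a
    using conds[THEN conjunct2, THEN conjunct2, THEN conjunct2, THEN conjunct2, THEN conjunct1,
        rule_format, OF that] .
  show "I \<in> F"
    if "J \<in> F" "right_ideal A I" "\<And>a. a \<in> J \<Longrightarrow> right_residual A I a \<in> F" for I J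
    using conds[THEN conjunct2, THEN conjunct2, THEN conjunct2, THEN conjunct2, THEN conjunct2,
        THEN spec, THEN bspec, OF that(1), THEN mp, OF conjI, OF that(2) ballI, OF that(3)] .
qed

lemma (in ring) derivation_vimage_mem_gabriel:
  assumes F: "right_gabriel_filter R F" and D: "derivation R D" and I: "I \<in> F"
  shows "{x \<in> I. D x \<in> I} \<in> F"
proof (rule gabriel_local[OF F I])
  note Ir = gabriel_right_ideal[OF F I]
  note Id = right_idealD[OF Ir]
  show J: "right_ideal R {x \<in> I. D x \<in> I}"
    by (rule right_ideal_derivation_vimage[OF D Ir])
  fix a assume a: "a \<in> I"
  have Dc: "D x \<in> carrier R" if "x \<in> carrier R" for x
    using D that by (auto simp: derivation_def)
  have ac: "a \<in> carrier R" using a Id(1) by auto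
  show "right_residual R {x \<in> I. D x \<in> I} a \<in> F"
  proof (rule gabriel_upward[OF F gabriel_residual[OF F I Dc[OF ac]]])
    show "right_ideal R (right_residual R {x \<in> I. D x \<in> I} a)"
      by (rule right_ideal_residual[OF J ac])
    \<comment> \<open>As \<open>a\<close> lies in \<open>I\<close>, so does
      \<open>a \<otimes> D r\<close>; what remains to be required of \<open>r\<close> is that
      \<open>D a \<otimes> r\<close> lies in \<open>I\<close>.\<close>
    have "D (a \<otimes> r) \<in> I" if "r \<in> carrier R" "D a \<otimes> r \<in> I" for r
    proof -
      have "D (a \<otimes> r) = (D a \<otimes> r) \<oplus> (a \<otimes> D r)"
        using D that ac by (simp add: derivation_def)
      then show ?thesis using that a Id(3,5) Dc by auto
    qed
    then show "right_residual R I (D a) \<subseteq> right_residual R {x \<in> I. D x \<in> I} a"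
      using a Id(5) by (auto simp: right_residual_def)
  qed
qed

lemma (in ring) gabriel_filter_differential:
  assumes "right_gabriel_filter R F"
  shows "differential_filter R F"
  unfolding differential_filter_def
proof (intro allI impI ballI)
  fix D I assume "derivation R D" "I \<in> F"
  then have "{x \<in> I. D x \<in> I} \<in> F" by (rule derivation_vimage_mem_gabriel[OF assms])
  then show "\<exists>J\<in>F. D ` J \<subseteq> I" by (rule bexI[rotated]) auto
qed

section \<open>The tensor product ring\<close>

text \<open>The product of formal sums nests one extension inside the function of another, so
  distributivity in the second factor is additivity in the function argument.\<close>

lemma frag_extend_add_fun: "frag_extend (\<lambda>x. f x + g x) p = frag_extend f p + frag_extend g p"
  by (simp add: frag_extend_def frag_cmul_distrib2 sum.distrib)

lemma frag_extend_diff_fun: "frag_extend (\<lambda>x. f x - g x) p = frag_extend f p - frag_extend g p"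
  using frag_extend_add_fun[of "\<lambda>x. f x - g x" g p] by simp

section \<open>The ring of formal sums of pairs\<close>

locale tensor_rings = A: ring A + B: ring B
  for A :: "('a, 'k) ring_scheme" and B :: "('b, 'l) ring_scheme"
begin

abbreviation F where "F \<equiv> free_tensor_ring A B"
abbreviation N where "N \<equiv> tensor_kernel A B"
abbreviation T where "T \<equiv> tensor_ring A B"
abbreviation cls where "cls p \<equiv> N +>\<^bsub>F\<^esub> p"

lemma F_simps:
  "p \<in> carrier F \<longleftrightarrow> Poly_Mapping.keys p \<subseteq> carrier A \<times> carrier B"
  "\<zero>\<^bsub>F\<^esub> = 0" "p \<oplus>\<^bsub>F\<^esub> q = p + q" "\<one>\<^bsub>F\<^esub> = frag_of (\<one>\<^bsub>A\<^esub>, \<one>\<^bsub>B\<^esub>)"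
  by (auto simp: free_tensor_ring_def)

lemma frag_of_closed [simp]: "frag_of (a, b) \<in> carrier F \<longleftrightarrow> a \<in> carrier A \<and> b \<in> carrier B"
  by (simp add: F_simps keys_frag_of)

lemma F_mult_of:
  "frag_of (a, b) \<otimes>\<^bsub>F\<^esub> frag_of (c, d) = frag_of (a \<otimes>\<^bsub>A\<^esub> c, b \<otimes>\<^bsub>B\<^esub> d)"
  by (simp add: free_tensor_ring_def)

text \<open>Both nested extensions are additive on all formal sums, whatever their support. Free of
  carrier conditions, these equations rewrite the difference cases of the inductions below
  directly.\<close>

lemma F_mult_distrib:
  "(p + p') \<otimes>\<^bsub>F\<^esub> q = p \<otimes>\<^bsub>F\<^esub> q + p' \<otimes>\<^bsub>F\<^esub> q"
  "p \<otimes>\<^bsub>F\<^esub> (q + q') = p \<otimes>\<^bsub>F\<^esub> q + p \<otimes>\<^bsub>F\<^esub> q'"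
  "(p - p') \<otimes>\<^bsub>F\<^esub> q = p \<otimes>\<^bsub>F\<^esub> q - p' \<otimes>\<^bsub>F\<^esub> q"
  "p \<otimes>\<^bsub>F\<^esub> (q - q') = p \<otimes>\<^bsub>F\<^esub> q - p \<otimes>\<^bsub>F\<^esub> q'"
  by (simp_all add: free_tensor_ring_def frag_extend_add frag_extend_diff case_prod_unfold
      frag_extend_add_fun frag_extend_diff_fun)

lemma F_diff_closed: "p \<in> carrier F \<Longrightarrow> q \<in> carrier F \<Longrightarrow> p - q \<in> carrier F"
  using keys_diff[of p q] by (auto simp: F_simps)

text \<open>A difference case covers sums, negatives and zero at once, so a property of formal sums
  is proved from generators and one additive step.\<close>

lemma F_induct [consumes 1, case_names of diff]:
  assumes "p \<in> carrier F"
    and of: "\<And>a b. a \<in> carrier A \<Longrightarrow> b \<in> carrier B \<Longrightarrow> P (frag_of (a, b))"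
    and diff: "\<And>p q. p \<in> carrier F \<Longrightarrow> q \<in> carrier F \<Longrightarrow> P p \<Longrightarrow> P q \<Longrightarrow> P (p - q)"
  shows "P p"
proof -
  have "p \<in> carrier F \<and> P p"
    using assms(1)[unfolded F_simps]
  proof (induction p rule: frag_induction)
    case zero
    \<comment> \<open>Zero is the difference of a generator with itself; the pair of ring zeros is a
      generator that is always available.\<close>
    have "P (frag_of (\<zero>\<^bsub>A\<^esub>, \<zero>\<^bsub>B\<^esub>) - frag_of (\<zero>\<^bsub>A\<^esub>, \<zero>\<^bsub>B\<^esub>))"
      by (intro diff of) auto
    then show ?case by (simp add: F_simps)
  next
    case (one x)
    then show ?case using of by (cases x) auto
  next
    case (diff p q)
    then show ?case using assms(3)[of p q] F_diff_closed[of p q] by blast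
  qed
  then show ?thesis ..
qed

lemma F_mult_closed:
  assumes "p \<in> carrier F" "q \<in> carrier F" shows "p \<otimes>\<^bsub>F\<^esub> q \<in> carrier F"
  using assms(1)
proof (induction p rule: F_induct)
  case (of a b)
  show ?case
    using assms(2)
  proof (induction q rule: F_induct)
    case (of c d)
    then show ?case using \<open>a \<in> carrier A\<close> \<open>b \<in> carrier B\<close> by (simp add: F_mult_of)
  next
    case (diff p q)
    then show ?case unfolding F_mult_distrib by (intro F_diff_closed)
  qed
next
  case (diff p q)
  then show ?case unfolding F_mult_distrib by (intro F_diff_closed)
qed

lemma F_mult_assoc:
  assumes "p \<in> carrier F" "q \<in> carrier F" "r \<in> carrier F"
  shows "(p \<otimes>\<^bsub>F\<^esub> q) \<otimes>\<^bsub>F\<^esub> r = p \<otimes>\<^bsub>F\<^esub> (q \<otimes>\<^bsub>F\<^esub> r)"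
  using assms(1)
proof (induction p rule: F_induct)
  case p: (of a b)
  show ?case
    using assms(2)
  proof (induction q rule: F_induct)
    case q: (of c d)
    show ?case
      using assms(3)
    proof (induction r rule: F_induct)
      case (of e f)
      then show ?case using p q by (simp add: F_mult_of A.m_assoc B.m_assoc)
    qed (simp only: F_mult_distrib)
  qed (simp only: F_mult_distrib)
qed (simp only: F_mult_distrib)

lemma F_mult_one:
  assumes "p \<in> carrier F"
  shows "\<one>\<^bsub>F\<^esub> \<otimes>\<^bsub>F\<^esub> p = p" "p \<otimes>\<^bsub>F\<^esub> \<one>\<^bsub>F\<^esub> = p"
  using assms
  by (induction p rule: F_induct)
    (simp_all only: F_simps F_mult_distrib F_mult_of A.l_one B.l_one A.r_one B.r_one)

lemma F_ring: "ring F"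
proof (rule ringI)
  show "abelian_group F"
  proof (rule abelian_groupI)
    show "\<exists>q\<in>carrier F. q \<oplus>\<^bsub>F\<^esub> p = \<zero>\<^bsub>F\<^esub>" if "p \<in> carrier F" for p
      using that by (intro bexI[of _ "- p"]) (auto simp: F_simps)
    show "p \<oplus>\<^bsub>F\<^esub> q \<in> carrier F" if "p \<in> carrier F" "q \<in> carrier F" for p q
      using that keys_add[of p q] by (auto simp: F_simps)
  qed (simp_all add: F_simps ac_simps)
  show "Group.monoid F"
    by (rule monoidI) (simp_all only: F_mult_closed F_mult_assoc F_mult_one,
      simp_all only: F_simps(4) frag_of_closed A.one_closed B.one_closed)
qed (simp_all only: F_simps F_mult_distrib)

sublocale F: ring F by (rule F_ring)

lemma F_neg:
  assumes "p \<in> carrier F" shows "\<ominus>\<^bsub>F\<^esub> p = - p"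
proof (rule F.minus_equality)
  show "- p \<in> carrier F" using assms by (simp add: F_simps)
  show "- p \<oplus>\<^bsub>F\<^esub> p = \<zero>\<^bsub>F\<^esub>" by (simp add: F_simps)
qed (rule assms)

lemma F_minus: "p \<in> carrier F \<Longrightarrow> q \<in> carrier F \<Longrightarrow> p \<ominus>\<^bsub>F\<^esub> q = p - q"
  by (simp add: F.minus_eq F_neg F_simps(3))

section \<open>The kernel of the tensor relations and the quotient by it\<close>

lemma tensor_relations_subset: "tensor_relations A B \<subseteq> carrier F"
proof
  fix n assume "n \<in> tensor_relations A B"
  then show "n \<in> carrier F"
    unfolding tensor_relations_def by (elim UnE CollectE exE) (simp_all add: F_diff_closed)
qed

lemma tensor_kernel_subgroup: "subgroup N (add_monoid F)"
  unfolding tensor_kernel_def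
  by (rule F.add.generate_is_subgroup) (use tensor_relations_subset in simp)

lemma tensor_relations_mult_of:
  assumes "n \<in> tensor_relations A B" "c \<in> carrier A" "d \<in> carrier B"
  shows "n \<otimes>\<^bsub>F\<^esub> frag_of (c, d) \<in> tensor_relations A B"
    and "frag_of (c, d) \<otimes>\<^bsub>F\<^esub> n \<in> tensor_relations A B"
proof -
  obtain a a' b b' where *: "a \<in> carrier A" "a' \<in> carrier A" "b \<in> carrier B" "b' \<in> carrier B"
    and n: "n = frag_of (a \<oplus>\<^bsub>A\<^esub> a', b) - frag_of (a, b) - frag_of (a', b) \<or>
      n = frag_of (a, b \<oplus>\<^bsub>B\<^esub> b') - frag_of (a, b) - frag_of (a, b')"
    using assms(1) unfolding tensor_relations_def by blast
  have rel: "frag_of (x \<oplus>\<^bsub>A\<^esub> x', y) - frag_of (x, y) - frag_of (x', y) \<in> tensor_relations A B"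
    "frag_of (x, y \<oplus>\<^bsub>B\<^esub> y') - frag_of (x, y) - frag_of (x, y') \<in> tensor_relations A B"
    if "x \<in> carrier A" "x' \<in> carrier A" "y \<in> carrier B" "y' \<in> carrier B" for x x' y y'
    using that unfolding tensor_relations_def by blast+
  show "n \<otimes>\<^bsub>F\<^esub> frag_of (c, d) \<in> tensor_relations A B"
    using n rel[of "a \<otimes>\<^bsub>A\<^esub> c" "a' \<otimes>\<^bsub>A\<^esub> c" "b \<otimes>\<^bsub>B\<^esub> d" "b' \<otimes>\<^bsub>B\<^esub> d"] * assms(2,3)
    by (auto simp: F_mult_distrib F_mult_of A.l_distr B.l_distr)
  show "frag_of (c, d) \<otimes>\<^bsub>F\<^esub> n \<in> tensor_relations A B"
    using n rel[of "c \<otimes>\<^bsub>A\<^esub> a" "c \<otimes>\<^bsub>A\<^esub> a'" "d \<otimes>\<^bsub>B\<^esub> b" "d \<otimes>\<^bsub>B\<^esub> b'"] * assms(2,3)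
    by (auto simp: F_mult_distrib F_mult_of A.r_distr B.r_distr)
qed

lemma additive_on_formal_sums:
  assumes "abelian_group G" and "h \<in> carrier F \<rightarrow> carrier G"
    and "\<And>p q. p \<in> carrier F \<Longrightarrow> q \<in> carrier F \<Longrightarrow> h (p + q) = h p \<oplus>\<^bsub>G\<^esub> h q"
  shows "abelian_group_hom F G h"
proof -
  interpret G: abelian_group G by fact
  show ?thesis
    using assms(2,3)
    by (intro abelian_group_homI group_hom.intro group_hom_axioms.intro
        F.abelian_group_axioms G.abelian_group_axioms F.add.is_group G.add.is_group homI)
      (auto simp: F_simps(3))
qed

text \<open>One half of the universal property of the tensor product. Later \<open>G\<close> is the
  tensor ring, for extending derivations, or a bimodule, for the action on it.\<close>

lemma additive_vanishes_on_kernel: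
  assumes "abelian_group_hom F G h"
    and "\<And>n. n \<in> tensor_relations A B \<Longrightarrow> h n = \<zero>\<^bsub>G\<^esub>" and "n \<in> N"
  shows "h n = \<zero>\<^bsub>G\<^esub>"
proof -
  interpret h: abelian_group_hom F G h by fact
  have rel: "m \<in> carrier F" "h m = \<zero>\<^bsub>G\<^esub>" if "m \<in> tensor_relations A B" for m
    using that tensor_relations_subset assms(2) by blast+
  have "n \<in> carrier F \<and> h n = \<zero>\<^bsub>G\<^esub>"
    using assms(3)[unfolded tensor_kernel_def]
  proof (induction rule: generate.induct)
    case one
    show ?case using h.hom_zero by simp
  next
    case (incl n)
    then show ?case using rel by simp
  next
    case (inv n)
    then have "\<ominus>\<^bsub>F\<^esub> n \<in> carrier F" "h (\<ominus>\<^bsub>F\<^esub> n) = \<zero>\<^bsub>G\<^esub>"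
      using rel[OF inv] by simp_all
    then show ?case by (simp only: a_inv_def[symmetric] simp_thms)
  next
    case (eng m n)
    then show ?case using F.add.m_closed[of m n] by simp
  qed
  then show ?thesis by blast
qed

lemma tensor_kernel_subset: "N \<subseteq> carrier F"
  using subgroup.subset[OF tensor_kernel_subgroup] by simp

lemma tensor_kernel_additive_subgroup: "additive_subgroup N F"
  using tensor_kernel_subgroup by (simp add: additive_subgroup_def)

lemma tensor_kernel_minus:
  assumes "m \<in> N" "n \<in> N" shows "m - n \<in> N"
proof -
  interpret kernel: additive_subgroup N F by (rule tensor_kernel_additive_subgroup)
  have "m \<in> carrier F" "n \<in> carrier F" using assms tensor_kernel_subset by blast+
  then have "m - n = m \<oplus>\<^bsub>F\<^esub> \<ominus>\<^bsub>F\<^esub> n" by (simp only: F.minus_eq[symmetric] F_minus)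
  then show ?thesis using assms by (simp only: kernel.a_closed kernel.a_inv_closed)
qed

lemma tensor_kernel_mult_of:
  assumes "n \<in> N" "c \<in> carrier A" "d \<in> carrier B"
  shows "n \<otimes>\<^bsub>F\<^esub> frag_of (c, d) \<in> N \<and> frag_of (c, d) \<otimes>\<^bsub>F\<^esub> n \<in> N"
proof -
  interpret kernel: additive_subgroup N F by (rule tensor_kernel_additive_subgroup)
  have g: "frag_of (c, d) \<in> carrier F" using assms(2,3) by (simp add: keys_frag_of)
  have rel: "n \<otimes>\<^bsub>F\<^esub> frag_of (c, d) \<in> N \<and> frag_of (c, d) \<otimes>\<^bsub>F\<^esub> n \<in> N" "n \<in> carrier F"
    if "n \<in> tensor_relations A B" for n
    using tensor_relations_mult_of[OF that assms(2,3)] tensor_relations_subset that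
    by (auto simp: tensor_kernel_def intro: generate.incl)
  have "n \<in> carrier F \<and> n \<otimes>\<^bsub>F\<^esub> frag_of (c, d) \<in> N \<and> frag_of (c, d) \<otimes>\<^bsub>F\<^esub> n \<in> N"
    using assms(1)[unfolded tensor_kernel_def]
  proof (induction rule: generate.induct)
    case one
    then show ?case using F.l_null[OF g] F.r_null[OF g] kernel.zero_closed by simp
  next
    case (incl n)
    then show ?case using rel by simp
  next
    case (inv n)
    then have "n \<in> carrier F" "\<ominus>\<^bsub>F\<^esub> n \<otimes>\<^bsub>F\<^esub> frag_of (c, d) \<in> N"
      "frag_of (c, d) \<otimes>\<^bsub>F\<^esub> \<ominus>\<^bsub>F\<^esub> n \<in> N"
      using rel[OF inv] g by (simp_all add: F.l_minus F.r_minus)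
    then show ?case by (simp only: a_inv_def[symmetric] F.a_inv_closed simp_thms)
  next
    case (eng m n)
    then show ?case using g F.add.m_closed[of m n] kernel.a_closed
      by (simp add: F.l_distr F.r_distr)
  qed
  then show ?thesis by blast
qed

text \<open>Two reductions meet here: \<open>tensor_kernel_mult_of\<close> descends from kernel
  elements to relations with a generator as multiplier, and \<open>F_induct\<close> then passes from
  generators to arbitrary multipliers.\<close>

lemma tensor_kernel_ideal: "ideal N F"
proof (rule idealI[OF F_ring tensor_kernel_subgroup])
  fix n p assume n: "n \<in> N" and "p \<in> carrier F"
  from this(2) have "n \<otimes>\<^bsub>F\<^esub> p \<in> N \<and> p \<otimes>\<^bsub>F\<^esub> n \<in> N"
  proof (induction p rule: F_induct)
    case (of a b)
    then show ?case using tensor_kernel_mult_of[OF n] by simp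
  next
    case (diff p q)
    then show ?case by (simp add: F_mult_distrib tensor_kernel_minus)
  qed
  then show "p \<otimes>\<^bsub>F\<^esub> n \<in> N" "n \<otimes>\<^bsub>F\<^esub> p \<in> N" by simp_all
qed

sublocale N: ideal N F by (rule tensor_kernel_ideal)

sublocale T: ring T
  unfolding tensor_ring_def by (rule N.quotient_is_ring)

sublocale cls: ring_hom_ring F T "\<lambda>p. cls p"
  unfolding tensor_ring_def by (rule N.rcos_ring_hom_ring)

lemma cls_surj: "t \<in> carrier T \<Longrightarrow> \<exists>p\<in>carrier F. t = cls p"
  by (auto simp: tensor_ring_def FactRing_def A_RCOSETS_def' a_r_coset_def')

lemma cls_minus:
  assumes "p \<in> carrier F" "q \<in> carrier F" shows "cls (p - q) = cls p \<ominus>\<^bsub>T\<^esub> cls q"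
proof -
  have "cls (p - q) = cls (p \<oplus>\<^bsub>F\<^esub> \<ominus>\<^bsub>F\<^esub> q)"
    using F_minus[OF assms] by (simp only: F.minus_eq)
  also have "\<dots> = cls p \<oplus>\<^bsub>T\<^esub> \<ominus>\<^bsub>T\<^esub> cls q"
    using assms by (simp only: cls.hom_add cls.hom_a_inv F.a_inv_closed)
  finally show ?thesis by (simp only: T.minus_eq)
qed

lemma cls_mem: "q \<in> cls p \<longleftrightarrow> (\<exists>n\<in>N. q = n \<oplus>\<^bsub>F\<^esub> p)"
  by (auto simp: a_r_coset_def')

text \<open>This makes definitions by representatives meaningful: \<open>env_derivation\<close> is a
  union over a coset and \<open>env_act\<close> picks the element of the image of a coset, and both
  collapse when the underlying map is constant on it.\<close>

lemma additive_const_on_cls: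
  assumes "abelian_group_hom F G h"
    and "\<And>n. n \<in> tensor_relations A B \<Longrightarrow> h n = \<zero>\<^bsub>G\<^esub>"
    and "p \<in> carrier F" "q \<in> cls p"
  shows "h q = h p"
proof -
  interpret h: abelian_group_hom F G h by fact
  obtain n where n: "n \<in> N" "q = n \<oplus>\<^bsub>F\<^esub> p" using assms(4) cls_mem by blast
  have "n \<in> carrier F" using n(1) tensor_kernel_subset by blast
  then have "h q = h n \<oplus>\<^bsub>G\<^esub> h p" using n(2) h.hom_add assms(3) by simp
  also have "\<dots> = h p"
    using additive_vanishes_on_kernel[OF assms(1,2) n(1)] h.hom_closed[OF assms(3)] by simp
  finally show ?thesis .
qed

lemma cls_eq_zero:
  assumes "n \<in> N" shows "cls n = \<zero>\<^bsub>T\<^esub>"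
proof -
  have "cls n = cls \<zero>\<^bsub>F\<^esub>"
    by (rule trans[OF N.a_rcos_const[OF assms] N.a_rcos_const[OF N.zero_closed, symmetric]])
  also have "\<dots> = \<zero>\<^bsub>T\<^esub>" by (rule cls.hom_zero)
  finally show ?thesis .
qed

section \<open>Pure tensors\<close>

abbreviation tn where "tn \<equiv> tens A B"

lemma tens_closed [simp]: "a \<in> carrier A \<Longrightarrow> b \<in> carrier B \<Longrightarrow> tn a b \<in> carrier T"
  unfolding tens_def by (rule cls.hom_closed) (simp add: keys_frag_of)

lemma tens_mult:
  assumes "a \<in> carrier A" "b \<in> carrier B" "c \<in> carrier A" "d \<in> carrier B"
  shows "tn a b \<otimes>\<^bsub>T\<^esub> tn c d = tn (a \<otimes>\<^bsub>A\<^esub> c) (b \<otimes>\<^bsub>B\<^esub> d)"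
  unfolding tens_def F_mult_of[symmetric]
  by (rule cls.hom_mult[symmetric]) (use assms in \<open>simp_all add: keys_frag_of\<close>)

lemma tens_one: "\<one>\<^bsub>T\<^esub> = tn \<one>\<^bsub>A\<^esub> \<one>\<^bsub>B\<^esub>"
  using cls.hom_one by (simp only: tens_def F_simps)

lemma tens_add:
  shows tens_add_left: "\<lbrakk>a \<in> carrier A; a' \<in> carrier A; b \<in> carrier B\<rbrakk> \<Longrightarrow>
      tn (a \<oplus>\<^bsub>A\<^esub> a') b = tn a b \<oplus>\<^bsub>T\<^esub> tn a' b"
    and tens_add_right: "\<lbrakk>a \<in> carrier A; b \<in> carrier B; b' \<in> carrier B\<rbrakk> \<Longrightarrow>
      tn a (b \<oplus>\<^bsub>B\<^esub> b') = tn a b \<oplus>\<^bsub>T\<^esub> tn a b'"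
proof -
  \<comment> \<open>Both families of relations subtract two generators from a third. Their class is
    zero, and moving the subtracted terms across yields additivity in either slot.\<close>
  have *: "tn x y = tn u v \<oplus>\<^bsub>T\<^esub> tn u' v'"
    if "frag_of (x, y) - frag_of (u, v) - frag_of (u', v') \<in> tensor_relations A B"
      "x \<in> carrier A" "y \<in> carrier B" "u \<in> carrier A" "v \<in> carrier B" "u' \<in> carrier A" "v' \<in> carrier B"
    for x y u v u' v'
  proof -
    have c: "frag_of (x, y) \<in> carrier F" "frag_of (u, v) \<in> carrier F" "frag_of (u', v') \<in> carrier F"
      using that by (simp_all add: keys_frag_of)
    have "frag_of (x, y) - frag_of (u, v) - frag_of (u', v') \<in> N"
      using that(1) by (simp add: tensor_kernel_def generate.incl)
    then have "\<zero>\<^bsub>T\<^esub> = cls (frag_of (x, y) - frag_of (u, v) - frag_of (u', v'))"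
      by (rule cls_eq_zero[symmetric])
    also have "\<dots> = (cls (frag_of (x, y)) \<ominus>\<^bsub>T\<^esub> cls (frag_of (u, v))) \<ominus>\<^bsub>T\<^esub> cls (frag_of (u', v'))"
      by (simp only: cls_minus F_diff_closed c)
    finally have "tn x y \<ominus>\<^bsub>T\<^esub> tn u v \<ominus>\<^bsub>T\<^esub> tn u' v' = \<zero>\<^bsub>T\<^esub>"
      by (simp add: tens_def)
    then have "tn x y \<ominus>\<^bsub>T\<^esub> (tn u v \<oplus>\<^bsub>T\<^esub> tn u' v') = \<zero>\<^bsub>T\<^esub>"
      using that by (simp add: T.minus_eq T.minus_add T.a_assoc)
    then have "\<ominus>\<^bsub>T\<^esub> (\<ominus>\<^bsub>T\<^esub> (tn u v \<oplus>\<^bsub>T\<^esub> tn u' v')) = tn x y"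
      using that by (intro T.minus_equality) (simp_all add: T.minus_eq)
    then show ?thesis using that by simp
  qed
  show "\<lbrakk>a \<in> carrier A; a' \<in> carrier A; b \<in> carrier B\<rbrakk> \<Longrightarrow>
      tn (a \<oplus>\<^bsub>A\<^esub> a') b = tn a b \<oplus>\<^bsub>T\<^esub> tn a' b"
    by (rule *) (auto simp: tensor_relations_def)
  show "\<lbrakk>a \<in> carrier A; b \<in> carrier B; b' \<in> carrier B\<rbrakk> \<Longrightarrow>
      tn a (b \<oplus>\<^bsub>B\<^esub> b') = tn a b \<oplus>\<^bsub>T\<^esub> tn a b'"
    by (rule *) (auto simp: tensor_relations_def)
qed

text \<open>Transport of \<open>F_induct\<close> along the surjection \<open>cls\<close>; every
  later identity that is additive in a tensor is reduced to pure tensors in this way.\<close>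

lemma tensor_induct [consumes 1, case_names tens minus]:
  assumes "t \<in> carrier T"
    and "\<And>a b. a \<in> carrier A \<Longrightarrow> b \<in> carrier B \<Longrightarrow> P (tn a b)"
    and "\<And>t u. t \<in> carrier T \<Longrightarrow> u \<in> carrier T \<Longrightarrow> P t \<Longrightarrow> P u \<Longrightarrow> P (t \<ominus>\<^bsub>T\<^esub> u)"
  shows "P t"
proof -
  obtain p where p: "p \<in> carrier F" "t = cls p" using cls_surj[OF assms(1)] by auto
  have "P (cls p)"
    using p(1)
  proof (induction p rule: F_induct)
    case (of a b)
    then show ?case using assms(2) by (simp add: tens_def)
  next
    case (diff p q)
    then show ?case using assms(3)[of "cls p" "cls q"] by (simp add: cls_minus)
  qed
  then show ?thesis using p by simp
qed

end

section \<open>Contraction of right ideals along a ring homomorphism\<close>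

lemma (in abelian_group_hom) hom_minus:
  assumes "x \<in> carrier G" "y \<in> carrier G"
  shows "h (x \<ominus>\<^bsub>G\<^esub> y) = h x \<ominus>\<^bsub>H\<^esub> h y"
  using assms by (simp add: a_minus_def)

definition contraction :: "('a, 'k) ring_scheme \<Rightarrow> ('a \<Rightarrow> 'b) \<Rightarrow> 'b set \<Rightarrow> 'a set"
  where "contraction R h K = {r \<in> carrier R. h r \<in> K}"

lemma (in ring) gabriel_carrier:
  assumes "right_gabriel_filter R F" shows "carrier R \<in> F"
proof -
  have "F \<noteq> {}" by (rule conjunct1[OF assms[unfolded right_gabriel_filter_def]])
  then obtain I where I: "I \<in> F" by blast
  have "right_ideal R (carrier R)" by (rule right_idealI) auto
  then show ?thesis
    by (rule gabriel_upward[OF assms I _ right_ideal_subset[OF gabriel_right_ideal[OF assms I]]])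
qed

lemma (in ring) generate_subset_right_ideal:
  assumes K: "right_ideal R K" and "G \<subseteq> K"
  shows "generate (add_monoid R) G \<subseteq> K"
proof
  interpret K: additive_subgroup K R using K by (simp add: right_ideal_def)
  fix x assume "x \<in> generate (add_monoid R) G"
  then show "x \<in> K"
  proof (induction rule: generate.induct)
    case one
    show ?case by simp
  next
    case (incl x)
    then show ?case using assms(2) by blast
  next
    case (inv x)
    then have "\<ominus> x \<in> K" using assms(2) by (intro K.a_inv_closed) blast
    then show ?case unfolding a_inv_def .
  next
    case (eng x y)
    then show ?case by simp
  qed
qed

context ring_hom_ring
begin

lemma right_ideal_contraction:
  assumes "right_ideal S K" shows "right_ideal R (contraction R h K)"
  by (rule R.right_idealI)
    (auto simp: contraction_def hom_minus S.right_ideal_zero[OF assms]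
      intro: S.right_ideal_minus[OF assms] S.right_ideal_mult[OF assms])

lemma contraction_residual:
  assumes "a \<in> carrier R"
  shows "contraction R h (right_residual S K (h a)) = right_residual R (contraction R h K) a"
  using assms by (auto simp: contraction_def right_residual_def)

text \<open>Locality in \<open>F\<close> tests only elements \<open>a\<close> with
  \<open>h a\<close> in \<open>L\<close>, and at elements \<open>h a\<close> contraction and
  residual commute.\<close>

lemma contraction_gabriel_local:
  assumes F: "right_gabriel_filter R F" and K: "right_ideal S K"
    and L: "contraction R h L \<in> F"
    and loc: "\<And>t. t \<in> L \<Longrightarrow> contraction R h (right_residual S K t) \<in> F"
  shows "contraction R h K \<in> F"
proof (rule gabriel_local[OF F L right_ideal_contraction[OF K]])
  fix a assume "a \<in> contraction R h L"
  then have "a \<in> carrier R" "h a \<in> L" by (simp_all add: contraction_def)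
  then show "right_residual R (contraction R h K) a \<in> F"
    using loc[of "h a"] by (simp only: contraction_residual)
qed

text \<open>The factor \<open>w\<close> need not be in the image of \<open>h\<close>, so
  \<open>contraction_residual\<close> does not apply to the product. Since \<open>w\<close> commutes
  past \<open>h r\<close>, the product \<open>h c w h r\<close> equals \<open>h c h r w\<close>,
  which stays in the right ideal \<open>K\<close> whenever \<open>h (c r)\<close> is in
  \<open>K\<close>. Thus the residual of the contraction at \<open>c\<close> is contained in the set
  in question.\<close>

lemma contraction_residual_commuting:
  assumes F: "right_gabriel_filter R F" and K: "right_ideal S K" and KF: "contraction R h K \<in> F"
    and c: "c \<in> carrier R" and w: "w \<in> carrier S"
    and comm: "\<And>a. a \<in> carrier R \<Longrightarrow> w \<otimes>\<^bsub>S\<^esub> h a = h a \<otimes>\<^bsub>S\<^esub> w"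
  shows "contraction R h (right_residual S K (h c \<otimes>\<^bsub>S\<^esub> w)) \<in> F"
proof (rule gabriel_upward[OF F gabriel_residual[OF F KF c]])
  show "right_ideal R (contraction R h (right_residual S K (h c \<otimes>\<^bsub>S\<^esub> w)))"
    using c w by (intro right_ideal_contraction S.right_ideal_residual K) auto
  have "h c \<otimes>\<^bsub>S\<^esub> w \<otimes>\<^bsub>S\<^esub> h r \<in> K" if "r \<in> carrier R" "h c \<otimes>\<^bsub>S\<^esub> h r \<in> K" for r
    using S.right_ideal_mult[OF K that(2) w] that(1) c w by (simp add: S.m_assoc comm)
  then show "right_residual R (contraction R h K) c
      \<subseteq> contraction R h (right_residual S K (h c \<otimes>\<^bsub>S\<^esub> w))"
    using c by (auto simp: contraction_def right_residual_def)
qed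

lemma contraction_residual_minus:
  assumes F: "right_gabriel_filter R F" and K: "right_ideal S K"
    and t: "t \<in> carrier S" "contraction R h (right_residual S K t) \<in> F"
    and u: "u \<in> carrier S" "contraction R h (right_residual S K u) \<in> F"
  shows "contraction R h (right_residual S K (t \<ominus>\<^bsub>S\<^esub> u)) \<in> F"
proof (rule gabriel_upward[OF F gabriel_inter[OF F t(2) u(2)]])
  show "right_ideal R (contraction R h (right_residual S K (t \<ominus>\<^bsub>S\<^esub> u)))"
    using t u by (intro right_ideal_contraction S.right_ideal_residual K) auto
  have "(t \<ominus>\<^bsub>S\<^esub> u) \<otimes>\<^bsub>S\<^esub> h r \<in> K"
    if "r \<in> carrier R" "t \<otimes>\<^bsub>S\<^esub> h r \<in> K" "u \<otimes>\<^bsub>S\<^esub> h r \<in> K" for r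
    using S.right_ideal_minus[OF K that(2,3)] that(1) t(1) u(1)
    by (simp add: S.minus_eq S.l_distr S.l_minus)
  then show "contraction R h (right_residual S K t) \<inter> contraction R h (right_residual S K u)
      \<subseteq> contraction R h (right_residual S K (t \<ominus>\<^bsub>S\<^esub> u))"
    by (auto simp: contraction_def right_residual_def)
qed

end

section \<open>A Gabriel filter on the tensor product from one on each factor\<close>

context tensor_rings
begin

abbreviation inl where "inl a \<equiv> tn a \<one>\<^bsub>B\<^esub>"
abbreviation inr where "inr b \<equiv> tn \<one>\<^bsub>A\<^esub> b"

lemma inl_hom: "ring_hom_ring A T inl"
  by (rule ring_hom_ringI[OF A.ring_axioms T.ring_axioms])
    (simp_all add: tens_mult tens_add_left tens_one)

lemma inr_hom: "ring_hom_ring B T inr"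
  by (rule ring_hom_ringI[OF B.ring_axioms T.ring_axioms])
    (simp_all add: tens_mult tens_add_right tens_one)

text \<open>In this form each filter axiom splits into one statement over \<open>A\<close> and one
  over \<open>B\<close>; \<open>tensor_filter_iff\<close> recovers the description by images of
  ideals.\<close>

definition tensor_filter where
  "tensor_filter FA FB =
    {K. right_ideal T K \<and> contraction A inl K \<in> FA \<and> contraction B inr K \<in> FB}"

lemma tensor_filter_gabriel:
  assumes FA: "right_gabriel_filter A FA" and FB: "right_gabriel_filter B FB"
  shows "right_gabriel_filter T (tensor_filter FA FB)"
proof -
  interpret l: ring_hom_ring A T inl by (rule inl_hom)
  interpret r: ring_hom_ring B T inr by (rule inr_hom)
  have carr: "carrier T \<in> tensor_filter FA FB"
  proof -
    have "contraction A inl (carrier T) = carrier A" "contraction B inr (carrier T) = carrier B"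
      by (auto simp: contraction_def)
    then show ?thesis
      using A.gabriel_carrier[OF FA] B.gabriel_carrier[OF FB]
      by (auto simp: tensor_filter_def intro: T.right_idealI)
  qed
  have up: "J \<in> tensor_filter FA FB"
    if I: "I \<in> tensor_filter FA FB" and J: "right_ideal T J" and IJ: "I \<subseteq> J" for I J
  proof -
    have "contraction A inl I \<subseteq> contraction A inl J" "contraction B inr I \<subseteq> contraction B inr J"
      using IJ by (auto simp: contraction_def)
    moreover have "contraction A inl I \<in> FA" "contraction B inr I \<in> FB"
      using I by (simp_all add: tensor_filter_def)
    ultimately show ?thesis
      using J gabriel_upward[OF FA _ l.right_ideal_contraction[OF J], of "contraction A inl I"]
        gabriel_upward[OF FB _ r.right_ideal_contraction[OF J], of "contraction B inr I"]
      by (simp add: tensor_filter_def)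
  qed
  have inter: "I \<inter> J \<in> tensor_filter FA FB"
    if "I \<in> tensor_filter FA FB" "J \<in> tensor_filter FA FB" for I J
  proof -
    have "contraction A inl (I \<inter> J) = contraction A inl I \<inter> contraction A inl J"
      "contraction B inr (I \<inter> J) = contraction B inr I \<inter> contraction B inr J"
      by (auto simp: contraction_def)
    then show ?thesis
      using that
      by (simp add: tensor_filter_def T.right_ideal_inter gabriel_inter[OF FA] gabriel_inter[OF FB])
  qed
  have res: "right_residual T K t \<in> tensor_filter FA FB"
    if K: "K \<in> tensor_filter FA FB" and t: "t \<in> carrier T" for K t
  proof -
    have Ki: "right_ideal T K" and KA: "contraction A inl K \<in> FA" and KB: "contraction B inr K \<in> FB"
      using K by (auto simp: tensor_filter_def)
    have "contraction A inl (right_residual T K t) \<in> FA \<and> contraction B inr (right_residual T K t) \<in> FB"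
      using t
    proof (induction t rule: tensor_induct)
      case (tens a b)
      \<comment> \<open>A pure tensor factors in both orders. Each contraction uses the order that
        begins with its own factor, leaving the other as the commuting \<open>w\<close>.\<close>
      have "contraction A inl (right_residual T K (inl a \<otimes>\<^bsub>T\<^esub> inr b)) \<in> FA"
        by (rule l.contraction_residual_commuting[OF FA Ki KA]) (use tens in \<open>simp_all add: tens_mult\<close>)
      moreover have "contraction B inr (right_residual T K (inr b \<otimes>\<^bsub>T\<^esub> inl a)) \<in> FB"
        by (rule r.contraction_residual_commuting[OF FB Ki KB]) (use tens in \<open>simp_all add: tens_mult\<close>)
      ultimately show ?case using tens by (simp add: tens_mult)
    next
      case (minus t u)
      then show ?case
        by (simp add: l.contraction_residual_minus[OF FA Ki] r.contraction_residual_minus[OF FB Ki])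
    qed
    then show ?thesis using T.right_ideal_residual[OF Ki t] by (simp add: tensor_filter_def)
  qed
  have loc: "I \<in> tensor_filter FA FB"
    if J: "J \<in> tensor_filter FA FB" and I: "right_ideal T I"
      and *: "\<And>t. t \<in> J \<Longrightarrow> right_residual T I t \<in> tensor_filter FA FB" for I J
  proof -
    have JA: "contraction A inl J \<in> FA" and JB: "contraction B inr J \<in> FB"
      using J by (simp_all add: tensor_filter_def)
    have res: "contraction A inl (right_residual T I t) \<in> FA"
      "contraction B inr (right_residual T I t) \<in> FB" if "t \<in> J" for t
      using *[OF that] by (simp_all add: tensor_filter_def)
    show ?thesis
      using I l.contraction_gabriel_local[OF FA I JA res(1)]
        r.contraction_gabriel_local[OF FB I JB res(2)]
      by (simp add: tensor_filter_def)
  qed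
  show ?thesis
    unfolding right_gabriel_filter_def
  proof (intro conjI ballI allI impI)
    show "tensor_filter FA FB \<noteq> {}" using carr by blast
    show "right_ideal T I" if "I \<in> tensor_filter FA FB" for I
      using that by (simp add: tensor_filter_def)
    show "J \<in> tensor_filter FA FB"
      if "I \<in> tensor_filter FA FB" "right_ideal T J \<and> I \<subseteq> J" for I J
      using up that by blast
    show "I \<inter> J \<in> tensor_filter FA FB"
      if "I \<in> tensor_filter FA FB" "J \<in> tensor_filter FA FB" for I J
      by (rule inter[OF that])
    show "right_residual T I a \<in> tensor_filter FA FB"
      if "I \<in> tensor_filter FA FB" "a \<in> carrier T" for I a
      by (rule res[OF that])
    show "I \<in> tensor_filter FA FB"
      if "J \<in> tensor_filter FA FB"
        "right_ideal T I \<and> (\<forall>a\<in>J. right_residual T I a \<in> tensor_filter FA FB)" for I J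
      by (rule loc[OF that(1)]) (use that(2) in blast)+
  qed
qed

text \<open>If a right ideal contains \<open>inl a\<close>, it contains \<open>inl a\<close> times
  \<open>inr b\<close>, the pure tensor of \<open>a\<close> and \<open>b\<close>; symmetrically for
  \<open>inr b\<close>. Conversely, the ring units put \<open>inl a\<close> and \<open>inr b\<close>
  into the two images, and padding with zero puts them into the sum.\<close>

lemma tensor_image_subset_iff:
  assumes K: "right_ideal T K" and "I \<subseteq> carrier A" "J \<subseteq> carrier B"
  shows "tensor_image A B I (carrier B) <+>\<^bsub>T\<^esub> tensor_image A B (carrier A) J \<subseteq> K
    \<longleftrightarrow> I \<subseteq> contraction A inl K \<and> J \<subseteq> contraction B inr K"
proof
  assume sub: "tensor_image A B I (carrier B) <+>\<^bsub>T\<^esub> tensor_image A B (carrier A) J \<subseteq> K"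
  have zero: "\<zero>\<^bsub>T\<^esub> \<in> tensor_image A B U V" for U V
    unfolding tensor_image_def using generate.one[of "add_monoid T"] by (simp only: monoid.simps)
  have mem: "tn u v \<in> tensor_image A B U V" if "u \<in> U" "v \<in> V" for u v U V
    unfolding tensor_image_def using that by (intro generate.incl) blast
  have add: "x \<oplus>\<^bsub>T\<^esub> y \<in> K"
    if "x \<in> tensor_image A B I (carrier B)" "y \<in> tensor_image A B (carrier A) J" for x y
    using sub that unfolding set_add_def' by blast
  have "inl a \<in> K" if "a \<in> I" for a
  proof -
    have "inl a \<oplus>\<^bsub>T\<^esub> \<zero>\<^bsub>T\<^esub> \<in> K" by (rule add[OF mem[OF that B.one_closed] zero])
    moreover have "a \<in> carrier A" using that assms(2) by blast
    ultimately show ?thesis by simp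
  qed
  moreover have "inr b \<in> K" if "b \<in> J" for b
  proof -
    have "\<zero>\<^bsub>T\<^esub> \<oplus>\<^bsub>T\<^esub> inr b \<in> K" by (rule add[OF zero mem[OF A.one_closed that]])
    moreover have "b \<in> carrier B" using that assms(3) by blast
    ultimately show ?thesis by simp
  qed
  ultimately show "I \<subseteq> contraction A inl K \<and> J \<subseteq> contraction B inr K"
    using assms(2,3) by (auto simp: contraction_def)
next
  assume sub: "I \<subseteq> contraction A inl K \<and> J \<subseteq> contraction B inr K"
  have "tn a b \<in> K" if "a \<in> I" "b \<in> carrier B" for a b
  proof -
    have "a \<in> carrier A" "inl a \<in> K" using sub that(1) by (auto simp: contraction_def)
    then show ?thesis using T.right_ideal_mult[OF K, of "inl a" "inr b"] that(2) by (simp add: tens_mult)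
  qed
  then have left: "tensor_image A B I (carrier B) \<subseteq> K"
    unfolding tensor_image_def by (intro T.generate_subset_right_ideal[OF K]) blast
  have "tn a b \<in> K" if "a \<in> carrier A" "b \<in> J" for a b
  proof -
    have "b \<in> carrier B" "inr b \<in> K" using sub that(2) by (auto simp: contraction_def)
    then show ?thesis using T.right_ideal_mult[OF K, of "inr b" "inl a"] that(1) by (simp add: tens_mult)
  qed
  then have right: "tensor_image A B (carrier A) J \<subseteq> K"
    unfolding tensor_image_def by (intro T.generate_subset_right_ideal[OF K]) blast
  show "tensor_image A B I (carrier B) <+>\<^bsub>T\<^esub> tensor_image A B (carrier A) J \<subseteq> K"
    using left right T.right_ideal_add[OF K] unfolding set_add_def' by blast
qed

text \<open>The ideal from \<open>FB\<close> is chosen first to match the quantifiers of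
  \<open>symmetric_filter\<close>, where the left ideal, belonging to the opposite ring, comes
  first.\<close>

lemma tensor_filter_iff:
  assumes FA: "right_gabriel_filter A FA" and FB: "right_gabriel_filter B FB"
  shows "K \<in> tensor_filter FA FB \<longleftrightarrow> right_ideal T K \<and> (\<exists>J\<in>FB. \<exists>I\<in>FA.
    tensor_image A B I (carrier B) <+>\<^bsub>T\<^esub> tensor_image A B (carrier A) J \<subseteq> K)"
proof (cases "right_ideal T K")
  case K: True
  have iff: "(tensor_image A B I (carrier B) <+>\<^bsub>T\<^esub> tensor_image A B (carrier A) J \<subseteq> K)
      = (I \<subseteq> contraction A inl K \<and> J \<subseteq> contraction B inr K)" if "I \<in> FA" "J \<in> FB" for I J
    by (rule tensor_image_subset_iff[OF K])
      (rule A.right_ideal_subset[OF gabriel_right_ideal[OF FA that(1)]],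
       rule B.right_ideal_subset[OF gabriel_right_ideal[OF FB that(2)]])
  have l: "contraction A inl K \<in> FA" if "I \<in> FA" "I \<subseteq> contraction A inl K" for I
    by (rule gabriel_upward[OF FA that(1) ring_hom_ring.right_ideal_contraction[OF inl_hom K] that(2)])
  have r: "contraction B inr K \<in> FB" if "J \<in> FB" "J \<subseteq> contraction B inr K" for J
    by (rule gabriel_upward[OF FB that(1) ring_hom_ring.right_ideal_contraction[OF inr_hom K] that(2)])
  have "(\<exists>J\<in>FB. \<exists>I\<in>FA.
      tensor_image A B I (carrier B) <+>\<^bsub>T\<^esub> tensor_image A B (carrier A) J \<subseteq> K)
    \<longleftrightarrow> contraction A inl K \<in> FA \<and> contraction B inr K \<in> FB"
  proof
    assume "\<exists>J\<in>FB. \<exists>I\<in>FA.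
      tensor_image A B I (carrier B) <+>\<^bsub>T\<^esub> tensor_image A B (carrier A) J \<subseteq> K"
    then obtain I J where "I \<in> FA" "J \<in> FB"
      "tensor_image A B I (carrier B) <+>\<^bsub>T\<^esub> tensor_image A B (carrier A) J \<subseteq> K"
      by (elim bexE)
    then show "contraction A inl K \<in> FA \<and> contraction B inr K \<in> FB"
      using iff[of I J] l[of I] r[of J] by simp
  next
    assume *: "contraction A inl K \<in> FA \<and> contraction B inr K \<in> FB"
    show "\<exists>J\<in>FB. \<exists>I\<in>FA.
      tensor_image A B I (carrier B) <+>\<^bsub>T\<^esub> tensor_image A B (carrier A) J \<subseteq> K"
      \<comment> \<open>The contractions of \<open>K\<close> are the largest ideals whose images lie
        in \<open>K\<close>, hence the natural witnesses.\<close>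
      by (rule bexI[of _ "contraction B inr K"], rule bexI[of _ "contraction A inl K"])
        (use * iff[of "contraction A inl K" "contraction B inr K"] in simp_all)
  qed
  then show ?thesis using K by (simp only: tensor_filter_def mem_Collect_eq simp_thms)
qed (simp add: tensor_filter_def)

end

lemma op_ring_simps [simp]:
  "carrier (op_ring R) = carrier R" "\<one>\<^bsub>op_ring R\<^esub> = \<one>\<^bsub>R\<^esub>" "\<zero>\<^bsub>op_ring R\<^esub> = \<zero>\<^bsub>R\<^esub>"
  "x \<oplus>\<^bsub>op_ring R\<^esub> y = x \<oplus>\<^bsub>R\<^esub> y" "x \<otimes>\<^bsub>op_ring R\<^esub> y = y \<otimes>\<^bsub>R\<^esub> x"
  by (simp_all add: op_ring_def)

lemma (in ring) op_ring_ring: "ring (op_ring R)"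
proof (rule ringI)
  show "abelian_group (op_ring R)"
    by (rule abelian_groupI) (auto simp: a_ac intro: l_neg bexI[of _ "\<ominus> _"])
  show "Group.monoid (op_ring R)"
    by (rule monoidI) (simp_all add: m_assoc)
qed (simp_all add: l_distr r_distr)

section \<open>The enveloping ring and its derivations\<close>

locale enveloping_ring = A: ring R for R :: "('a, 'k) ring_scheme"
begin

sublocale tensor_rings R "op_ring R"
  by (intro tensor_rings.intro A.ring_axioms A.op_ring_ring)

text \<open>Left ideals of \<open>R\<close> are right ideals of \<open>op_ring R\<close>, the second
  tensor factor, which explains the exchanged order of the two filters.\<close>

lemma symmetric_filter_eq:
  assumes "left_gabriel_filter R Fl" "right_gabriel_filter R Fr"
  shows "symmetric_filter R Fl Fr = tensor_filter Fr Fl"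
  using tensor_filter_iff[OF assms(2) assms(1)[unfolded left_gabriel_filter_def]]
  by (auto simp: symmetric_filter_def env_ring_def)

lemma symmetric_filter_gabriel:
  assumes "left_gabriel_filter R Fl" "right_gabriel_filter R Fr"
  shows "right_gabriel_filter (env_ring R) (symmetric_filter R Fl Fr)"
  unfolding symmetric_filter_eq[OF assms] env_ring_def
  by (rule tensor_filter_gabriel[OF assms(2) assms(1)[unfolded left_gabriel_filter_def]])

end

lemma (in ring) l_distr_minus:
  "\<lbrakk>x \<in> carrier R; y \<in> carrier R; z \<in> carrier R\<rbrakk> \<Longrightarrow> (x \<ominus> y) \<otimes> z = x \<otimes> z \<ominus> y \<otimes> z"
  by (simp add: minus_eq l_distr l_minus)

lemma (in ring) r_distr_minus:
  "\<lbrakk>x \<in> carrier R; y \<in> carrier R; z \<in> carrier R\<rbrakk> \<Longrightarrow> z \<otimes> (x \<ominus> y) = z \<otimes> x \<ominus> z \<otimes> y"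
  by (simp add: minus_eq r_distr r_minus)

lemma (in abelian_group) add_minus_add:
  assumes "x \<in> carrier G" "y \<in> carrier G" "z \<in> carrier G" "w \<in> carrier G"
  shows "(x \<oplus> y) \<ominus> (z \<oplus> w) = (x \<ominus> z) \<oplus> (y \<ominus> w)"
  using assms by (simp add: minus_eq minus_add a_ac)

section \<open>Extension of a derivation to the enveloping ring\<close>

context enveloping_ring
begin

context
  fixes \<delta> :: "'a \<Rightarrow> 'a"
  assumes \<delta>: "derivation R \<delta>"
begin

lemma derivation_closed [simp]: "r \<in> carrier R \<Longrightarrow> \<delta> r \<in> carrier R"
  using \<delta> by (auto simp: derivation_def)

lemma derivation_add:
  "r \<in> carrier R \<Longrightarrow> s \<in> carrier R \<Longrightarrow> \<delta> (r \<oplus>\<^bsub>R\<^esub> s) = \<delta> r \<oplus>\<^bsub>R\<^esub> \<delta> s"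
  using \<delta> by (simp add: derivation_def)

lemma derivation_mult:
  "r \<in> carrier R \<Longrightarrow> s \<in> carrier R \<Longrightarrow>
    \<delta> (r \<otimes>\<^bsub>R\<^esub> s) = (\<delta> r \<otimes>\<^bsub>R\<^esub> s) \<oplus>\<^bsub>R\<^esub> (r \<otimes>\<^bsub>R\<^esub> \<delta> s)"
  using \<delta> by (simp add: derivation_def)

text \<open>On formal sums this map is additive, but the Leibniz rule in general holds only modulo
  the kernel: a generator with a sum in one slot is not a sum of generators. The rule is therefore
  proved on the quotient.\<close>

definition formal_derivation :: "('a \<times> 'a \<Rightarrow>\<^sub>0 int) \<Rightarrow> ('a \<times> 'a \<Rightarrow>\<^sub>0 int)"
  where "formal_derivation = frag_extend (\<lambda>(r, s). frag_of (\<delta> r, s) + frag_of (r, \<delta> s))"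

lemma formal_derivation_of: "formal_derivation (frag_of (r, s)) = frag_of (\<delta> r, s) + frag_of (r, \<delta> s)"
  by (simp add: formal_derivation_def)

lemma formal_derivation_diff:
  "formal_derivation (p - q) = formal_derivation p - formal_derivation q"
  by (simp add: formal_derivation_def frag_extend_diff)

lemma formal_derivation_closed:
  assumes "p \<in> carrier F" shows "formal_derivation p \<in> carrier F"
  using assms
proof (induction p rule: F_induct)
  case (of a b)
  then have "frag_of (\<delta> a, b) \<oplus>\<^bsub>F\<^esub> frag_of (a, \<delta> b) \<in> carrier F" by (intro F.a_closed) simp_all
  then show ?case by (simp only: formal_derivation_of F_simps(3))
next
  case (diff p q)
  then show ?case by (simp only: formal_derivation_diff F_diff_closed)
qed

lemma cls_formal_derivation_hom: "abelian_group_hom F T (\<lambda>p. cls (formal_derivation p))"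
proof (rule additive_on_formal_sums[OF T.abelian_group_axioms])
  show "(\<lambda>p. cls (formal_derivation p)) \<in> carrier F \<rightarrow> carrier T"
    by (rule funcsetI) (rule cls.hom_closed, rule formal_derivation_closed)
  fix p q assume "p \<in> carrier F" "q \<in> carrier F"
  then have "cls (formal_derivation p \<oplus>\<^bsub>F\<^esub> formal_derivation q)
      = cls (formal_derivation p) \<oplus>\<^bsub>T\<^esub> cls (formal_derivation q)"
    by (intro cls.hom_add formal_derivation_closed)
  then show "cls (formal_derivation (p + q)) = cls (formal_derivation p) \<oplus>\<^bsub>T\<^esub> cls (formal_derivation q)"
    by (simp only: F_simps(3) formal_derivation_def frag_extend_add)
qed

lemma cls_formal_derivation_of:
  assumes "a \<in> carrier R" "b \<in> carrier R"
  shows "cls (formal_derivation (frag_of (a, b))) = tn (\<delta> a) b \<oplus>\<^bsub>T\<^esub> tn a (\<delta> b)"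
proof -
  have "cls (frag_of (\<delta> a, b) \<oplus>\<^bsub>F\<^esub> frag_of (a, \<delta> b)) = tn (\<delta> a) b \<oplus>\<^bsub>T\<^esub> tn a (\<delta> b)"
    unfolding tens_def by (rule cls.hom_add) (use assms in simp_all)
  then show ?thesis by (simp only: formal_derivation_of F_simps(3))
qed

text \<open>By additivity of \<delta>, a relation is sent to a sum of two relations of the same
  kind, one with \<delta> applied in the first slot and one with \<delta> applied in the second, up
  to the kernel.\<close>

lemma cls_formal_derivation_relation:
  assumes "n \<in> tensor_relations R (op_ring R)"
  shows "cls (formal_derivation n) = \<zero>\<^bsub>T\<^esub>"
proof -
  interpret h: abelian_group_hom F T "\<lambda>p. cls (formal_derivation p)"
    by (rule cls_formal_derivation_hom)
  have minus: "cls (formal_derivation (frag_of (x, y) - frag_of (u, v) - frag_of (u', v')))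
    = (tn (\<delta> x) y \<oplus>\<^bsub>T\<^esub> tn x (\<delta> y)) \<ominus>\<^bsub>T\<^esub> (tn (\<delta> u) v \<oplus>\<^bsub>T\<^esub> tn u (\<delta> v))
      \<ominus>\<^bsub>T\<^esub> (tn (\<delta> u') v' \<oplus>\<^bsub>T\<^esub> tn u' (\<delta> v'))"
    if "x \<in> carrier R" "y \<in> carrier R" "u \<in> carrier R" "v \<in> carrier R" "u' \<in> carrier R" "v' \<in> carrier R"
    for x y u v u' v'
    using that
    by (simp add: formal_derivation_diff cls_minus F_diff_closed formal_derivation_closed
        cls_formal_derivation_of)
  \<comment> \<open>Here \<open>x\<close> and \<open>y\<close> are the terms with \<delta> in the
    first slot, \<open>z\<close> and \<open>w\<close> those with \<delta> in the second; the
    subtracted sums group them by generator instead.\<close>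
  have cancel: "x \<oplus>\<^bsub>T\<^esub> y \<oplus>\<^bsub>T\<^esub> (z \<oplus>\<^bsub>T\<^esub> w) \<ominus>\<^bsub>T\<^esub> (x \<oplus>\<^bsub>T\<^esub> z) \<ominus>\<^bsub>T\<^esub> (y \<oplus>\<^bsub>T\<^esub> w) = \<zero>\<^bsub>T\<^esub>"
    if "x \<in> carrier T" "y \<in> carrier T" "z \<in> carrier T" "w \<in> carrier T" for x y z w
  proof -
    have "x \<oplus>\<^bsub>T\<^esub> y \<oplus>\<^bsub>T\<^esub> (z \<oplus>\<^bsub>T\<^esub> w) \<ominus>\<^bsub>T\<^esub> (x \<oplus>\<^bsub>T\<^esub> z) \<ominus>\<^bsub>T\<^esub> (y \<oplus>\<^bsub>T\<^esub> w)
      = ((x \<oplus>\<^bsub>T\<^esub> z) \<oplus>\<^bsub>T\<^esub> (y \<oplus>\<^bsub>T\<^esub> w)) \<oplus>\<^bsub>T\<^esub> \<ominus>\<^bsub>T\<^esub> ((x \<oplus>\<^bsub>T\<^esub> z) \<oplus>\<^bsub>T\<^esub> (y \<oplus>\<^bsub>T\<^esub> w))"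
      using that by (simp add: T.minus_eq T.minus_add T.a_ac)
    then show ?thesis using that by (simp add: T.r_neg)
  qed
  from assms consider
      a a' b where "a \<in> carrier R" "a' \<in> carrier R" "b \<in> carrier R"
        "n = frag_of (a \<oplus>\<^bsub>R\<^esub> a', b) - frag_of (a, b) - frag_of (a', b)"
    | a b b' where "a \<in> carrier R" "b \<in> carrier R" "b' \<in> carrier R"
        "n = frag_of (a, b \<oplus>\<^bsub>R\<^esub> b') - frag_of (a, b) - frag_of (a, b')"
    unfolding tensor_relations_def op_ring_simps by blast
  then show ?thesis
  proof cases
    case 1
    then have *: "tn (\<delta> a \<oplus>\<^bsub>R\<^esub> \<delta> a') b = tn (\<delta> a) b \<oplus>\<^bsub>T\<^esub> tn (\<delta> a') b"
      "tn (a \<oplus>\<^bsub>R\<^esub> a') (\<delta> b) = tn a (\<delta> b) \<oplus>\<^bsub>T\<^esub> tn a' (\<delta> b)"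
      by (intro tens_add_left; simp)+
    show ?thesis using 1 by (simp add: minus derivation_add * cancel)
  next
    case 2
    then have *: "tn (\<delta> a) (b \<oplus>\<^bsub>R\<^esub> b') = tn (\<delta> a) b \<oplus>\<^bsub>T\<^esub> tn (\<delta> a) b'"
      "tn a (\<delta> b \<oplus>\<^bsub>R\<^esub> \<delta> b') = tn a (\<delta> b) \<oplus>\<^bsub>T\<^esub> tn a (\<delta> b')"
      using tens_add_right[of "\<delta> a" b b'] tens_add_right[of a "\<delta> b" "\<delta> b'"] by simp_all
    show ?thesis using 2 by (simp add: minus derivation_add * cancel)
  qed
qed

lemma env_derivation_cls:
  assumes p: "p \<in> carrier F"
  shows "env_derivation R \<delta> (cls p) = cls (formal_derivation p)"
proof -
  have "cls (formal_derivation q) = cls (formal_derivation p)" if "q \<in> cls p" for q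
    by (rule additive_const_on_cls[OF cls_formal_derivation_hom cls_formal_derivation_relation p that])
  moreover have "cls p \<noteq> {}" using N.a_rcos_self[OF p] by blast
  ultimately have "(\<Union>q\<in>cls p. cls (formal_derivation q)) = cls (formal_derivation p)"
    by simp
  then show ?thesis by (simp only: env_derivation_def formal_derivation_def)
qed

lemma env_derivation_tens:
  assumes "a \<in> carrier R" "b \<in> carrier R"
  shows "env_derivation R \<delta> (tn a b) = tn (\<delta> a) b \<oplus>\<^bsub>T\<^esub> tn a (\<delta> b)"
proof -
  have "env_derivation R \<delta> (tn a b) = cls (formal_derivation (frag_of (a, b)))"
    unfolding tens_def by (rule env_derivation_cls) (use assms in simp)
  also have "\<dots> = tn (\<delta> a) b \<oplus>\<^bsub>T\<^esub> tn a (\<delta> b)" by (rule cls_formal_derivation_of[OF assms])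
  finally show ?thesis .
qed

lemma env_derivation_hom: "abelian_group_hom T T (env_derivation R \<delta>)"
proof -
  interpret h: abelian_group_hom F T "\<lambda>p. cls (formal_derivation p)"
    by (rule cls_formal_derivation_hom)
  have "env_derivation R \<delta> t \<in> carrier T" if "t \<in> carrier T" for t
    using cls_surj[OF that] h.hom_closed by (auto simp: env_derivation_cls)
  moreover have "env_derivation R \<delta> (t \<oplus>\<^bsub>T\<^esub> u) = env_derivation R \<delta> t \<oplus>\<^bsub>T\<^esub> env_derivation R \<delta> u"
    if t: "t \<in> carrier T" and u: "u \<in> carrier T" for t u
  proof -
    obtain p q where p: "p \<in> carrier F" "t = cls p" and q: "q \<in> carrier F" "u = cls q"
      using cls_surj[OF t] cls_surj[OF u] by (elim bexE)
    have "env_derivation R \<delta> (cls (p \<oplus>\<^bsub>F\<^esub> q)) = env_derivation R \<delta> (cls p) \<oplus>\<^bsub>T\<^esub> env_derivation R \<delta> (cls q)"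
      using p(1) q(1) by (simp only: env_derivation_cls F.a_closed h.hom_add)
    then show ?thesis using p q by (simp only: cls.hom_add)
  qed
  ultimately show ?thesis
    by (intro abelian_group_homI group_hom.intro group_hom_axioms.intro
        T.abelian_group_axioms T.add.is_group homI) simp_all
qed

text \<open>Both sides of the Leibniz rule are additive in \<open>t\<close> and in \<open>u\<close>,
  which leaves pure tensors. There the rule for \<delta> is applied in each slot; it also holds for
  the reversed product of the opposite ring, where its two terms merely swap.\<close>

lemma env_derivation_derivation: "derivation (env_ring R) (env_derivation R \<delta>)"
proof -
  interpret D: abelian_group_hom T T "env_derivation R \<delta>" by (rule env_derivation_hom)
  let ?D = "env_derivation R \<delta>"
  have "?D (t \<otimes>\<^bsub>T\<^esub> u) = (?D t \<otimes>\<^bsub>T\<^esub> u) \<oplus>\<^bsub>T\<^esub> (t \<otimes>\<^bsub>T\<^esub> ?D u)"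
    if "t \<in> carrier T" and u: "u \<in> carrier T" for t u
    using that(1)
  proof (induction t rule: tensor_induct)
    case t: (tens a b)
    show ?case
      using u
    proof (induction u rule: tensor_induct)
      case (tens c d)
      have "?D (tn a b \<otimes>\<^bsub>T\<^esub> tn c d) = tn (\<delta> a \<otimes>\<^bsub>R\<^esub> c) (d \<otimes>\<^bsub>R\<^esub> b) \<oplus>\<^bsub>T\<^esub> tn (a \<otimes>\<^bsub>R\<^esub> \<delta> c) (d \<otimes>\<^bsub>R\<^esub> b)
          \<oplus>\<^bsub>T\<^esub> (tn (a \<otimes>\<^bsub>R\<^esub> c) (\<delta> d \<otimes>\<^bsub>R\<^esub> b) \<oplus>\<^bsub>T\<^esub> tn (a \<otimes>\<^bsub>R\<^esub> c) (d \<otimes>\<^bsub>R\<^esub> \<delta> b))"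
        using t tens tens_add_left[of "\<delta> a \<otimes>\<^bsub>R\<^esub> c" "a \<otimes>\<^bsub>R\<^esub> \<delta> c" "d \<otimes>\<^bsub>R\<^esub> b"]
          tens_add_right[of "a \<otimes>\<^bsub>R\<^esub> c" "\<delta> d \<otimes>\<^bsub>R\<^esub> b" "d \<otimes>\<^bsub>R\<^esub> \<delta> b"]
        by (simp add: tens_mult env_derivation_tens derivation_mult)
      also have "\<dots> = (?D (tn a b) \<otimes>\<^bsub>T\<^esub> tn c d) \<oplus>\<^bsub>T\<^esub> (tn a b \<otimes>\<^bsub>T\<^esub> ?D (tn c d))"
        using t tens
        by (simp add: tens_mult env_derivation_tens T.l_distr T.r_distr T.a_ac)
      finally show ?case .
    next
      case (minus u v)
      have x: "tn a b \<in> carrier T" using t by simp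
      show ?case
        using x minus
        by (simp add: T.r_distr_minus D.hom_minus T.add_minus_add)
    qed
  next
    case (minus t v)
    then show ?case
      using u by (simp add: T.l_distr_minus D.hom_minus T.add_minus_add)
  qed
  then show ?thesis
    unfolding derivation_def env_ring_def by (intro conjI ballI funcsetI) simp_all
qed

end

end

section \<open>Bimodules as modules over the enveloping ring\<close>

lemma (in abelian_group) int_multiple:
  fixes k l :: int
  assumes "x \<in> carrier G"
  shows int_multiple_closed: "[k] \<cdot> x \<in> carrier G"
    and int_multiple_zero: "[(0 :: int)] \<cdot> x = \<zero>"
    and int_multiple_one: "[(1 :: int)] \<cdot> x = x"
    and int_multiple_add: "[(k + l)] \<cdot> x = [k] \<cdot> x \<oplus> [l] \<cdot> x"
proof -
  have x: "x \<in> carrier (add_monoid G)" using assms by simp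
  show "[k] \<cdot> x \<in> carrier G"
    using group.int_pow_closed[OF a_group x, of k] by (simp add: add_pow_def)
  show "[(0 :: int)] \<cdot> x = \<zero>"
    using int_pow_0[of "add_monoid G" x] by (simp add: add_pow_def)
  show "[(1 :: int)] \<cdot> x = x"
    using group.int_pow_1[OF a_group x] by (simp add: add_pow_def)
  show "[(k + l)] \<cdot> x = [k] \<cdot> x \<oplus> [l] \<cdot> x"
    using group.int_pow_mult[OF a_group x, of k l] by (simp add: add_pow_def)
qed

context bimodule
begin

lemma lact_hom: "s \<in> carrier R \<Longrightarrow> abelian_group_hom M M (lact M s)"
  by (intro abelian_group_homI group_hom.intro group_hom_axioms.intro
      M.abelian_group_axioms M.add.is_group homI) (simp_all add: lact_closed lact_add)

lemma ract_hom: "r \<in> carrier R \<Longrightarrow> abelian_group_hom M M (\<lambda>x. ract M x r)"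
  by (intro abelian_group_homI group_hom.intro group_hom_axioms.intro
      M.abelian_group_axioms M.add.is_group homI) (simp_all add: ract_closed ract_add)

sublocale E: enveloping_ring R
  by (rule enveloping_ring.intro) (rule R.ring_axioms)

text \<open>Cancellation can make the support of \<open>p + q\<close> smaller than the union of the
  supports. Additivity therefore compares sums over a common finite index set, whose extra terms are
  zero multiples.\<close>

lemma formal_act_superset:
  assumes x: "x \<in> carrier M" and "finite S" and S: "S \<subseteq> carrier R \<times> carrier R"
    and "Poly_Mapping.keys p \<subseteq> S"
  shows "formal_act M x p =
    finsum M (\<lambda>(r, s). [Poly_Mapping.lookup p (r, s)] \<cdot>\<^bsub>M\<^esub> lact M s (ract M x r)) S"
  unfolding formal_act_def
  by (rule M.add.finprod_mono_neutral_cong_left)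
    (use assms in \<open>auto simp: in_keys_iff M.int_multiple lact_closed ract_closed\<close>)

lemma formal_act_hom:
  assumes x: "x \<in> carrier M"
  shows "abelian_group_hom E.F M (formal_act M x)"
proof (rule E.additive_on_formal_sums[OF M.abelian_group_axioms])
  show "formal_act M x \<in> carrier E.F \<rightarrow> carrier M"
    using x by (auto simp: formal_act_def E.F_simps intro!: M.finsum_closed M.int_multiple_closed lact_closed ract_closed)
  fix p q assume "p \<in> carrier E.F" "q \<in> carrier E.F"
  then have pq: "Poly_Mapping.keys p \<union> Poly_Mapping.keys q \<subseteq> carrier R \<times> carrier R" (is "?S \<subseteq> _")
    by (auto simp: E.F_simps)
  let ?g = "\<lambda>(p :: 'a \<times> 'a \<Rightarrow>\<^sub>0 int) (r, s). [Poly_Mapping.lookup p (r, s)] \<cdot>\<^bsub>M\<^esub> lact M s (ract M x r)"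
  have sup: "formal_act M x u = finsum M (?g u) ?S" if "Poly_Mapping.keys u \<subseteq> ?S" for u
    by (rule formal_act_superset[OF x _ pq that]) simp
  have closed: "?g u \<in> ?S \<rightarrow> carrier M" for u
  proof (rule funcsetI)
    fix k assume "k \<in> ?S"
    then obtain r s where "k = (r, s)" "r \<in> carrier R" "s \<in> carrier R" using pq by blast
    then show "?g u k \<in> carrier M" using x by (simp add: M.int_multiple_closed lact_closed ract_closed)
  qed
  have "formal_act M x (p + q) = finsum M (?g (p + q)) ?S"
    by (rule sup) (rule keys_add)
  also have "\<dots> = finsum M (\<lambda>k. ?g p k \<oplus>\<^bsub>M\<^esub> ?g q k) ?S"
  proof (rule M.finsum_cong')
    show "(\<lambda>k. ?g p k \<oplus>\<^bsub>M\<^esub> ?g q k) \<in> ?S \<rightarrow> carrier M"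
      using closed[of p] closed[of q] by (intro funcsetI M.a_closed) (erule funcset_mem, assumption)+
    fix k assume "k \<in> ?S"
    then obtain r s where k: "k = (r, s)" "r \<in> carrier R" "s \<in> carrier R" using pq by blast
    then have "lact M s (ract M x r) \<in> carrier M" using x by (simp add: lact_closed ract_closed)
    then show "?g (p + q) k = ?g p k \<oplus>\<^bsub>M\<^esub> ?g q k"
      using k by (simp add: lookup_add M.int_multiple_add)
  qed simp
  also have "\<dots> = finsum M (?g p) ?S \<oplus>\<^bsub>M\<^esub> finsum M (?g q) ?S"
    by (rule M.finsum_addf[OF closed closed])
  also have "\<dots> = formal_act M x p \<oplus>\<^bsub>M\<^esub> formal_act M x q"
    by (simp add: sup)
  finally show "formal_act M x (p + q) = formal_act M x p \<oplus>\<^bsub>M\<^esub> formal_act M x q" .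
qed

lemma formal_act_of:
  assumes "x \<in> carrier M" "r \<in> carrier R" "s \<in> carrier R"
  shows "formal_act M x (frag_of (r, s)) = lact M s (ract M x r)"
  using assms by (simp add: formal_act_def keys_frag_of M.int_multiple_one lact_closed ract_closed)

lemma formal_act_relation:
  assumes x: "x \<in> carrier M" and n: "n \<in> tensor_relations R (op_ring R)"
  shows "formal_act M x n = \<zero>\<^bsub>M\<^esub>"
proof -
  interpret h: abelian_group_hom E.F M "formal_act M x" by (rule formal_act_hom[OF x])
  have minus: "formal_act M x (frag_of (a, b) - frag_of (c, d) - frag_of (e, f))
    = lact M b (ract M x a) \<ominus>\<^bsub>M\<^esub> lact M d (ract M x c) \<ominus>\<^bsub>M\<^esub> lact M f (ract M x e)"
    if "a \<in> carrier R" "b \<in> carrier R" "c \<in> carrier R" "d \<in> carrier R" "e \<in> carrier R" "f \<in> carrier R"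
    for a b c d e f
  proof -
    have "formal_act M x ((frag_of (a, b) \<ominus>\<^bsub>E.F\<^esub> frag_of (c, d)) \<ominus>\<^bsub>E.F\<^esub> frag_of (e, f))
      = lact M b (ract M x a) \<ominus>\<^bsub>M\<^esub> lact M d (ract M x c) \<ominus>\<^bsub>M\<^esub> lact M f (ract M x e)"
      using that x by (simp add: h.hom_minus formal_act_of)
    then show ?thesis using that by (simp add: E.F_minus E.F_diff_closed)
  qed
  have cancel: "y \<oplus>\<^bsub>M\<^esub> z \<ominus>\<^bsub>M\<^esub> y \<ominus>\<^bsub>M\<^esub> z = \<zero>\<^bsub>M\<^esub>" if "y \<in> carrier M" "z \<in> carrier M" for y z
  proof -
    have "y \<oplus>\<^bsub>M\<^esub> z \<ominus>\<^bsub>M\<^esub> y \<ominus>\<^bsub>M\<^esub> z = (y \<oplus>\<^bsub>M\<^esub> z) \<oplus>\<^bsub>M\<^esub> \<ominus>\<^bsub>M\<^esub> (y \<oplus>\<^bsub>M\<^esub> z)"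
      using that by (simp add: M.minus_eq M.minus_add M.a_assoc)
    then show ?thesis using that by (simp add: M.r_neg)
  qed
  from n consider
      a a' b where "a \<in> carrier R" "a' \<in> carrier R" "b \<in> carrier R"
        "n = frag_of (a \<oplus>\<^bsub>R\<^esub> a', b) - frag_of (a, b) - frag_of (a', b)"
    | a b b' where "a \<in> carrier R" "b \<in> carrier R" "b' \<in> carrier R"
        "n = frag_of (a, b \<oplus>\<^bsub>R\<^esub> b') - frag_of (a, b) - frag_of (a, b')"
    unfolding tensor_relations_def op_ring_simps by blast
  then show ?thesis
    by cases (use x in \<open>simp_all add: minus cancel ract_add_scalar lact_add lact_add_scalar
      lact_closed ract_closed\<close>)
qed

lemma env_act_cls:
  assumes x: "x \<in> carrier M" and p: "p \<in> carrier E.F"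
  shows "env_act M x (E.cls p) = formal_act M x p"
proof -
  have "formal_act M x q = formal_act M x p" if "q \<in> E.cls p" for q
    by (rule E.additive_const_on_cls[OF formal_act_hom[OF x] formal_act_relation[OF x] p that])
  moreover have "E.cls p \<noteq> {}" using E.N.a_rcos_self[OF p] by blast
  ultimately have "formal_act M x ` E.cls p = {formal_act M x p}" by auto
  then show ?thesis by (simp add: env_act_def)
qed

lemma env_act_tens:
  assumes "x \<in> carrier M" "r \<in> carrier R" "s \<in> carrier R"
  shows "env_act M x (E.tn r s) = lact M s (ract M x r)"
  unfolding tens_def using assms by (simp add: env_act_cls formal_act_of)

lemma env_act_hom:
  assumes x: "x \<in> carrier M"
  shows "abelian_group_hom E.T M (env_act M x)"
proof -
  interpret h: abelian_group_hom E.F M "formal_act M x" by (rule formal_act_hom[OF x])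
  have "env_act M x t \<in> carrier M" if "t \<in> carrier E.T" for t
    using E.cls_surj[OF that] x h.hom_closed by (auto simp: env_act_cls)
  moreover have "env_act M x (t \<oplus>\<^bsub>E.T\<^esub> u) = env_act M x t \<oplus>\<^bsub>M\<^esub> env_act M x u"
    if t: "t \<in> carrier E.T" and u: "u \<in> carrier E.T" for t u
  proof -
    obtain p q where p: "p \<in> carrier E.F" "t = E.cls p" and q: "q \<in> carrier E.F" "u = E.cls q"
      using E.cls_surj[OF t] E.cls_surj[OF u] by (elim bexE)
    have "env_act M x (E.cls (p \<oplus>\<^bsub>E.F\<^esub> q)) = env_act M x (E.cls p) \<oplus>\<^bsub>M\<^esub> env_act M x (E.cls q)"
      using p(1) q(1) x by (simp only: env_act_cls E.F.a_closed h.hom_add)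
    then show ?thesis using p q by (simp only: E.cls.hom_add)
  qed
  ultimately show ?thesis
    by (intro abelian_group_homI group_hom.intro group_hom_axioms.intro
        E.T.abelian_group_axioms M.abelian_group_axioms E.T.add.is_group M.add.is_group homI) simp_all
qed

text \<open>The second slot multiplies in reverse, so \<open>(a \<otimes> b) (c \<otimes> d)\<close>
  is \<open>ac \<otimes> db\<close> and acts as \<open>d (b x a) c\<close>. With the outer action
  written by \<open>lact\<close> and \<open>ract\<close>, which are additive, annihilation of
  \<open>x\<close> by \<open>t\<close> passes at once to the product.\<close>

lemma env_act_mult_tens:
  assumes x: "x \<in> carrier M" and "t \<in> carrier E.T" and c: "c \<in> carrier R" and d: "d \<in> carrier R"
  shows "env_act M x (t \<otimes>\<^bsub>E.T\<^esub> E.tn c d) = lact M d (ract M (env_act M x t) c)"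
  using assms(2)
proof (induction t rule: E.tensor_induct)
  case (tens a b)
  then show ?case
    using x c d
    by (simp add: E.tens_mult env_act_tens lact_mult ract_mult lact_ract lact_closed ract_closed)
next
  case (minus t u)
  interpret h: abelian_group_hom E.T M "env_act M x" by (rule env_act_hom[OF x])
  interpret l: abelian_group_hom M M "lact M d" by (rule lact_hom[OF d])
  interpret r: abelian_group_hom M M "\<lambda>x. ract M x c" by (rule ract_hom[OF c])
  show ?case
    using minus c d
    by (simp add: E.T.l_distr_minus h.hom_minus l.hom_minus r.hom_minus)
qed

lemma right_ideal_env_ann:
  assumes x: "x \<in> carrier M"
  shows "right_ideal (env_ring R) (env_ann R M x)"
proof -
  interpret h: abelian_group_hom E.T M "env_act M x" by (rule env_act_hom[OF x])
  have ann: "env_act M x (t \<otimes>\<^bsub>E.T\<^esub> u) = \<zero>\<^bsub>M\<^esub>"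
    if t: "t \<in> carrier E.T" "env_act M x t = \<zero>\<^bsub>M\<^esub>" and u: "u \<in> carrier E.T" for t u
    using u
  proof (induction u rule: E.tensor_induct)
    case (tens c d)
    interpret l: abelian_group_hom M M "lact M d" by (rule lact_hom) (use tens in simp)
    interpret r: abelian_group_hom M M "\<lambda>x. ract M x c" by (rule ract_hom) (use tens in simp)
    show ?case using t x tens r.hom_zero l.hom_zero by (simp add: env_act_mult_tens)
  next
    case (minus u v)
    then show ?case using t by (simp add: E.T.r_distr_minus h.hom_minus M.minus_eq)
  qed
  show ?thesis
    unfolding env_ann_def env_ring_def
  proof (rule E.T.right_idealI)
    show "t \<ominus>\<^bsub>E.T\<^esub> u \<in> {t \<in> carrier E.T. env_act M x t = \<zero>\<^bsub>M\<^esub>}"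
      if "t \<in> {t \<in> carrier E.T. env_act M x t = \<zero>\<^bsub>M\<^esub>}" "u \<in> {t \<in> carrier E.T. env_act M x t = \<zero>\<^bsub>M\<^esub>}"
      for t u
      using that by (simp add: h.hom_minus M.minus_eq)
  qed (use ann in auto)
qed

text \<open>Both sides are additive in \<open>t\<close>. For \<open>t = a \<otimes> b\<close> the
  left side is \<open>d (b x a)\<close>, a sum of \<open>(\<delta> b) x a\<close>,
  \<open>b (d x) a\<close> and \<open>b x (\<delta> a)\<close>: the middle term is the action of
  \<open>t\<close> on \<open>d x\<close>, the other two are the action of the derivative of
  \<open>t\<close> on \<open>x\<close>.\<close>

lemma env_act_derivation:
  assumes \<delta>: "derivation R \<delta>" and d: "bimodule_derivation R M \<delta> d"
    and x: "x \<in> carrier M" and t: "t \<in> carrier E.T"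
  shows "d (env_act M x t) = env_act M (d x) t \<oplus>\<^bsub>M\<^esub> env_act M x (env_derivation R \<delta> t)"
  using t
proof (induction t rule: E.tensor_induct)
  have dx: "d x \<in> carrier M" using d x by (auto simp: bimodule_derivation_def)
  interpret D: abelian_group_hom E.T E.T "env_derivation R \<delta>" by (rule E.env_derivation_hom[OF \<delta>])
  interpret hx: abelian_group_hom E.T M "env_act M x" by (rule env_act_hom[OF x])
  interpret hd: abelian_group_hom E.T M "env_act M (d x)" by (rule env_act_hom[OF dx])
  {
    case (tens a b)
    have \<delta>c: "\<delta> a \<in> carrier R" "\<delta> b \<in> carrier R" using E.derivation_closed[OF \<delta>] tens by simp_all
    have "d (lact M b (ract M x a)) = lact M (\<delta> b) (ract M x a)
        \<oplus>\<^bsub>M\<^esub> lact M b (ract M (d x) a \<oplus>\<^bsub>M\<^esub> ract M x (\<delta> a))"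
      using d x tens by (simp add: bimodule_derivation_def ract_closed)
    also have "\<dots> = lact M b (ract M (d x) a)
        \<oplus>\<^bsub>M\<^esub> (lact M b (ract M x (\<delta> a)) \<oplus>\<^bsub>M\<^esub> lact M (\<delta> b) (ract M x a))"
      using x dx tens \<delta>c by (simp add: lact_add lact_closed ract_closed M.a_ac)
    also have "\<dots> = env_act M (d x) (E.tn a b) \<oplus>\<^bsub>M\<^esub> env_act M x (env_derivation R \<delta> (E.tn a b))"
      using x dx tens \<delta>c by (simp add: E.env_derivation_tens[OF \<delta>] env_act_tens M.a_ac lact_closed ract_closed)
    finally show ?case using x tens by (simp add: env_act_tens)
  next
    case (minus t u)
    interpret d: abelian_group_hom M M d
      by (intro abelian_group_homI group_hom.intro group_hom_axioms.intro
          M.abelian_group_axioms M.add.is_group homI)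
        (use d in \<open>auto simp: bimodule_derivation_def\<close>)
    show ?case using minus by (simp add: hx.hom_minus hd.hom_minus D.hom_minus d.hom_minus M.add_minus_add)
  }
qed

lemma symmetric_torsion_derivation:
  assumes Fl: "left_gabriel_filter R Fl" and Fr: "right_gabriel_filter R Fr"
    and \<delta>: "derivation R \<delta>" and d: "bimodule_derivation R M \<delta> d"
    and x: "x \<in> symmetric_torsion R Fl Fr M"
  shows "d x \<in> symmetric_torsion R Fl Fr M"
proof -
  have xM: "x \<in> carrier M" and ann: "env_ann R M x \<in> symmetric_filter R Fl Fr"
    using x by (simp_all add: symmetric_torsion_def)
  have dx: "d x \<in> carrier M" using d xM by (auto simp: bimodule_derivation_def)
  interpret d: abelian_group_hom M M d
    by (intro abelian_group_homI group_hom.intro group_hom_axioms.intro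
        M.abelian_group_axioms M.add.is_group homI)
      (use d in \<open>auto simp: bimodule_derivation_def\<close>)
  interpret hd: abelian_group_hom E.T M "env_act M (d x)" by (rule env_act_hom[OF dx])
  interpret env: ring "env_ring R" unfolding env_ring_def by (rule E.T.ring_axioms)
  note filter = E.symmetric_filter_gabriel[OF Fl Fr]
  let ?J = "{t \<in> env_ann R M x. env_derivation R \<delta> t \<in> env_ann R M x}"
  have "?J \<in> symmetric_filter R Fl Fr"
    by (rule env.derivation_vimage_mem_gabriel[OF filter E.env_derivation_derivation[OF \<delta>] ann])
  moreover have "?J \<subseteq> env_ann R M (d x)"
  proof
    fix t assume "t \<in> ?J"
    then have t: "t \<in> carrier E.T" "env_act M x t = \<zero>\<^bsub>M\<^esub>"
      and Dt: "env_act M x (env_derivation R \<delta> t) = \<zero>\<^bsub>M\<^esub>"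
      by (simp_all add: env_ann_def env_ring_def)
    \<comment> \<open>The zero on the left is \<open>d (env_act M x t)\<close>, as \<open>t\<close>
      annihilates \<open>x\<close> and \<open>d\<close> is additive.\<close>
    have "\<zero>\<^bsub>M\<^esub> = env_act M (d x) t \<oplus>\<^bsub>M\<^esub> \<zero>\<^bsub>M\<^esub>"
      using env_act_derivation[OF \<delta> d xM t(1)] t(2) Dt d.hom_zero by simp
    then show "t \<in> env_ann R M (d x)"
      using t(1) hd.hom_closed[OF t(1)] by (simp add: env_ann_def env_ring_def)
  qed
  ultimately have "env_ann R M (d x) \<in> symmetric_filter R Fl Fr"
    using gabriel_upward[OF filter _ right_ideal_env_ann[OF dx]] by simp
  then show ?thesis using dx by (simp add: symmetric_torsion_def)
qed

end

(* Bimodules have carriers in 'm. The last two assumptions say only that 'm is large enough to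
   hold a copy of every bimodule with at most max(|R|, aleph_0) elements. Conditions (2) and (3) for
   arbitrary bimodules reduce to such ones, by passing to the sub-bimodule generated by
   x, d x, d (d x), ... *)
theorem proposition3:
  fixes R :: "('a, 'k) ring_scheme"
    and Fl Fr :: "'a set set"
    and \<iota> :: "'a \<Rightarrow> 'm"
  assumes "ring R"
    and "left_gabriel_filter R Fl"
    and "right_gabriel_filter R Fr"
    and "infinite (UNIV :: 'm set)"
    and "inj_on \<iota> (carrier R)"
  shows
    "(differential_filter (env_ring R) (symmetric_filter R Fl Fr) \<longleftrightarrow>
       (\<forall>(M :: ('a, 'm) bimodule) \<delta> d.
          bimodule R M \<longrightarrow> derivation R \<delta> \<longrightarrow> bimodule_derivation R M \<delta> d \<longrightarrow>
          d ` symmetric_torsion R Fl Fr M \<subseteq> symmetric_torsion R Fl Fr M)) \<and>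
     (differential_filter (env_ring R) (symmetric_filter R Fl Fr) \<longleftrightarrow>
       (\<forall>(M :: ('a, 'm) bimodule) \<delta>.
          bimodule R M \<longrightarrow> derivation R \<delta> \<longrightarrow>
          (\<forall>x\<in>symmetric_torsion R Fl Fr M.
             \<exists>K\<in>symmetric_filter R Fl Fr. env_derivation R \<delta> ` K \<subseteq> env_ann R M x))) \<and>
     (differential_filter R Fl \<and> differential_filter R Fr \<longrightarrow>
       differential_filter (env_ring R) (symmetric_filter R Fl Fr))"
proof -
  interpret E: enveloping_ring R using assms(1) by (rule enveloping_ring.intro)
  interpret env: ring "env_ring R" unfolding env_ring_def by (rule E.T.ring_axioms)
  have differential: "differential_filter (env_ring R) (symmetric_filter R Fl Fr)"
    by (rule env.gabriel_filter_differential[OF E.symmetric_filter_gabriel[OF assms(2,3)]])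
  have "d ` symmetric_torsion R Fl Fr M \<subseteq> symmetric_torsion R Fl Fr M"
    if "bimodule R M" "derivation R \<delta>" "bimodule_derivation R M \<delta> d"
    for M :: "('a, 'm) bimodule" and \<delta> d
    by (rule image_subsetI)
      (rule bimodule.symmetric_torsion_derivation[OF that(1) assms(2,3) that(2,3)])
  then have 2: "\<forall>(M :: ('a, 'm) bimodule) \<delta> d.
      bimodule R M \<longrightarrow> derivation R \<delta> \<longrightarrow> bimodule_derivation R M \<delta> d \<longrightarrow>
      d ` symmetric_torsion R Fl Fr M \<subseteq> symmetric_torsion R Fl Fr M"
    by (intro allI impI)
  have "\<exists>K\<in>symmetric_filter R Fl Fr. env_derivation R \<delta> ` K \<subseteq> env_ann R M x"
    if "derivation R \<delta>" "x \<in> symmetric_torsion R Fl Fr M" for M :: "('a, 'm) bimodule" and \<delta> x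
  proof -
    have "env_ann R M x \<in> symmetric_filter R Fl Fr"
      using that(2) by (simp add: symmetric_torsion_def)
    then show ?thesis
      by (rule differential[unfolded differential_filter_def, THEN spec, THEN mp, THEN bspec,
            OF E.env_derivation_derivation[OF that(1)]])
  qed
  then have 3: "\<forall>(M :: ('a, 'm) bimodule) \<delta>.
      bimodule R M \<longrightarrow> derivation R \<delta> \<longrightarrow>
      (\<forall>x\<in>symmetric_torsion R Fl Fr M.
         \<exists>K\<in>symmetric_filter R Fl Fr. env_derivation R \<delta> ` K \<subseteq> env_ann R M x)"
    by (intro allI impI ballI)
  show ?thesis
    by (intro conjI iffI impI differential 2 3)
qed

end
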